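(* Let $S$ be a positive integer and let $\{\psi_{j,k}: j=-1,0,1,\dots,\ k\in I_j\}$ be a boundary-corrected $S$-regular orthonormal wavelet basis of $L^2([0,1])$ as described in the context. Let $0<\beta_1\le\beta_2<S$ and $0<R_1\le R_2<\infty$. Consider the model in which one observes $(Y_t)_{t\in[0,1]}$ with $$dY_t = 2\sqrt{f(t)}\,dt + n^{-1/2}dW_t,\qquad t\in[0,1],$$ where $W$ is a standard Brownian motion and $f:[0,1]\to[0,\infty)$ is unknown; $\mathbb{P}_f$ denotes the law of the data. Fix $\tau>2\sqrt2$, choose $J_n$ with $n/2\le 2^{J_n}\le n$, put $Y_{j,k}=\int_0^1\psi_{j,k}(t)\,dY_t$, $$\widehat h=\sum_{j=-1}^{J_n}\sum_{k\in I_j} Y_{j,k}\,\mathbf 1\big(|Y_{j,k}|>\tau\sqrt{\log n/n}\big)\psi_{j,k},\qquad \widehat f=\widehat h^{\,2}/4 .$$ Let $$\tilde r^P_{n,\beta}(u)=\Big(\frac{\log n}{n}\Big)^{\frac{\beta}{\beta+1}}\vee\Big(u\,\frac{\log n}{n}\Big)^{\frac{\beta}{2\beta+1}},\qquad u\ge0.$$ Then there is a constant $C=C(\beta_1,\beta_2,R_1,R_2)$ such that $$\inf_{\substack{\beta_1\le\beta\le\beta_2\\ R_1\le R\le R_2}}\ \inf_{f:\ \|f\|_{\mathcal H^\beta}\le R}\ \mathbb{P}_f\Big(\sup_{x\in[0,1]}\frac{|\widehat f(x)-f(x)|}{\tilde r^P_{n,\beta}(f(x))}\le C\Big)\ \ge\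 1-\frac{3n^{-(\tau^2/8-1)}}{\sqrt{2\log n}} .$$
   Context: For $\beta>0$, $\lfloor\beta\rfloor$ denotes the greatest integer strictly smaller than $\beta$. For $f:[0,1]\to\mathbb R$ with $f^{(\lfloor\beta\rfloor)}$ existing, $|f|_{C^\beta}=\sup_{x\ne y}|f^{(\lfloor\beta\rfloor)}(x)-f^{(\lfloor\beta\rfloor)}(y)|/|x-y|^{\beta-\lfloor\beta\rfloor}$ and $\|f\|_{C^\beta}=\|f\|_\infty+\|f^{(\lfloor\beta\rfloor)}\|_\infty+|f|_{C^\beta}$ (sup-norms on $[0,1]$). The seminorm $|f|_{\mathcal H^\beta}=\max_{1\le j<\beta}\big(\sup_{x\in[0,1]}|f^{(j)}(x)|^\beta/|f(x)|^{\beta-j}\big)^{1/j}$, with $0/0:=0$ and $|f|_{\mathcal H^\beta}=0$ if $\beta\le1$. $\|f\|_{\mathcal H^\beta}=\|f\|_{C^\beta}+|f|_{\mathcal H^\beta}$ and $\mathcal H^\beta=\{f\in C^\beta: f\ge0,\ \|f\|_{\mathcal H^\beta}<\infty\}$. Wavelets: $\phi,\psi$ are bounded, compactly supported $S$-regular scaling and wavelet functions; the dilated/translated functions whose support meets $[0,1]$ are boundary-corrected (Cohen–Daubechies–Vial) to form an orthonormal basis $\{\psi_{j,k}: j\ge -1, k\in I_j\}$ of $L^2([0,1])$, with $\psi_{-1,k}$ the scaling functions and $|I_j|\le c2^j$. $a\vee b=\max(a,b)$. *)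

theory Defs
  imports "HOL-Probability.Probability"
begin

(* floor convention of the paper: greatest integer strictly smaller than beta *)
definition lfloor :: "real \<Rightarrow> nat" where
  "lfloor \<beta> = nat (\<lceil>\<beta>\<rceil> - 1)"

(* D k plays the role of f^(k) on [0,1] (one-sided derivatives at the endpoints).
   H_ball beta R f  <->  f \<in> H^beta and ||f||_{H^beta} <= R, where the norm is
   ||f||_inf + ||f^(m)||_inf + |f|_{C^beta} + |f|_{H^beta}, m = lfloor beta;
   each sup is encoded by an upper bound a, b, c, d (sum of sups <= R iff such bounds exist). *)
definition H_ball :: "real \<Rightarrow> real \<Rightarrow> (real \<Rightarrow> real) \<Rightarrow> bool" where
  "H_ball \<beta> R f \<longleftrightarrow>
     (\<forall>x\<in>{0..1}. 0 \<le> f x) \<and>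
     (\<exists>D :: nat \<Rightarrow> real \<Rightarrow> real.
        (\<forall>x\<in>{0..1}. D 0 x = f x) \<and>
        (\<forall>k<lfloor \<beta>. \<forall>x\<in>{0..1}.
            (D k has_real_derivative D (Suc k) x) (at x within {0..1})) \<and>
        (\<exists>a b c d.
           (\<forall>x\<in>{0..1}. \<bar>f x\<bar> \<le> a) \<and>
           (\<forall>x\<in>{0..1}. \<bar>D (lfloor \<beta>) x\<bar> \<le> b) \<and>
           (\<forall>x\<in>{0..1}. \<forall>y\<in>{0..1}. x \<noteq> y \<longrightarrow>
               \<bar>D (lfloor \<beta>) x - D (lfloor \<beta>) y\<bar> \<le> c * \<bar>x - y\<bar> powr (\<beta> - real (lfloor \<beta>))) \<and>
           0 \<le> d \<and>
           (\<forall>j::nat. 1 \<le> j \<and> real j < \<beta> \<longrightarrow>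
              (\<forall>x\<in>{0..1}. \<bar>D j x\<bar> powr \<beta> \<le> d ^ j * \<bar>f x\<bar> powr (\<beta> - real j))) \<and>
           a + b + c + d \<le> R))"

definition wavelet_basis :: "nat \<Rightarrow> (int \<Rightarrow> int \<Rightarrow> real \<Rightarrow> real) \<Rightarrow> (int \<Rightarrow> int set) \<Rightarrow> bool" where
  "wavelet_basis S \<psi> I \<longleftrightarrow> (\<exists>c>0.
     (\<forall>j\<ge>-1. finite (I j) \<and> real (card (I j)) \<le> c * 2 powr (real_of_int j)) \<and>
     (\<forall>j\<ge>-1. \<forall>k\<in>I j.
        \<psi> j k \<in> borel_measurable borel \<and> continuous_on {0..1} (\<psi> j k) \<and>
        (\<forall>x\<in>{0..1}. \<bar>\<psi> j k x\<bar> \<le> c * 2 powr (real_of_int j / 2)) \<and>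
        (\<exists>a. \<forall>x\<in>{0..1}. \<psi> j k x \<noteq> 0 \<longrightarrow> \<bar>x - a\<bar> \<le> c * 2 powr (- real_of_int j))) \<and>
     (\<forall>j\<ge>-1. \<forall>x\<in>{0..1}. real (card {k\<in>I j. \<psi> j k x \<noteq> 0}) \<le> c) \<and>
     (\<forall>j\<ge>-1. \<forall>k\<in>I j. \<forall>j'\<ge>-1. \<forall>k'\<in>I j'.
        (LINT t:{0..1}|lborel. \<psi> j k t * \<psi> j' k' t) = (if j = j' \<and> k = k' then 1 else 0)) \<and>
     (\<forall>g. g \<in> borel_measurable borel \<longrightarrow> set_integrable lborel {0..1} (\<lambda>t. (g t)\<^sup>2) \<longrightarrow>
        (\<forall>j\<ge>-1. \<forall>k\<in>I j. (LINT t:{0..1}|lborel. \<psi> j k t * g t) = 0) \<longrightarrow>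
        (AE t in lborel. t \<in> {0..1} \<longrightarrow> g t = 0)) \<and>
     (\<forall>j\<ge>0. \<forall>k\<in>I j. \<forall>m<S. (LINT t:{0..1}|lborel. \<psi> j k t * t ^ m) = 0))"

(* Gaussian white noise on [0,1] (isonormal process on L^2[0,1]):
   W g = \<integral>_0^1 g(t) dW_t for a standard Brownian motion W. *)
definition isonormal :: "'a measure \<Rightarrow> ((real \<Rightarrow> real) \<Rightarrow> 'a \<Rightarrow> real) \<Rightarrow> bool" where
  "isonormal M W \<longleftrightarrow>
     (\<forall>g. g \<in> borel_measurable borel \<and> set_integrable lborel {0..1} (\<lambda>t. (g t)\<^sup>2) \<longrightarrow>
        W g \<in> borel_measurable M \<and>
        (let s = sqrt (LINT t:{0..1}|lborel. (g t)\<^sup>2) in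
           if 0 < s then distributed M lborel (W g) (\<lambda>x. ennreal (normal_density 0 s x))
           else (AE \<omega> in M. W g \<omega> = 0))) \<and>
     (\<forall>g h a b. g \<in> borel_measurable borel \<and> set_integrable lborel {0..1} (\<lambda>t. (g t)\<^sup>2) \<and>
        h \<in> borel_measurable borel \<and> set_integrable lborel {0..1} (\<lambda>t. (h t)\<^sup>2) \<longrightarrow>
        (AE \<omega> in M. W (\<lambda>t. a * g t + b * h t) \<omega> = a * W g \<omega> + b * W h \<omega>))"

(* Y_{j,k} = \<integral> psi_{j,k} dY  with  dY = 2 sqrt f dt + n^{-1/2} dW *)
definition Ycoef :: "((real \<Rightarrow> real) \<Rightarrow> 'a \<Rightarrow> real) \<Rightarrow> (int \<Rightarrow> int \<Rightarrow> real \<Rightarrow> real) \<Rightarrow> nat \<Rightarrow>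
    (real \<Rightarrow> real) \<Rightarrow> int \<Rightarrow> int \<Rightarrow> 'a \<Rightarrow> real" where
  "Ycoef W \<psi> n f j k \<omega> =
     2 * (LINT t:{0..1}|lborel. \<psi> j k t * sqrt (f t)) + W (\<psi> j k) \<omega> / sqrt (real n)"

definition hhat :: "((real \<Rightarrow> real) \<Rightarrow> 'a \<Rightarrow> real) \<Rightarrow> (int \<Rightarrow> int \<Rightarrow> real \<Rightarrow> real) \<Rightarrow> (int \<Rightarrow> int set) \<Rightarrow>
    real \<Rightarrow> nat \<Rightarrow> nat \<Rightarrow> (real \<Rightarrow> real) \<Rightarrow> 'a \<Rightarrow> real \<Rightarrow> real" where
  "hhat W \<psi> I \<tau> n J f \<omega> x =
     (\<Sum>j\<in>{-1..int J}. \<Sum>k\<in>I j.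
        Ycoef W \<psi> n f j k \<omega> *
        (if \<bar>Ycoef W \<psi> n f j k \<omega>\<bar> > \<tau> * sqrt (ln (real n) / real n) then 1 else 0) * \<psi> j k x)"

definition fhat :: "((real \<Rightarrow> real) \<Rightarrow> 'a \<Rightarrow> real) \<Rightarrow> (int \<Rightarrow> int \<Rightarrow> real \<Rightarrow> real) \<Rightarrow> (int \<Rightarrow> int set) \<Rightarrow>
    real \<Rightarrow> nat \<Rightarrow> nat \<Rightarrow> (real \<Rightarrow> real) \<Rightarrow> 'a \<Rightarrow> real \<Rightarrow> real" where
  "fhat W \<psi> I \<tau> n J f \<omega> x = (hhat W \<psi> I \<tau> n J f \<omega> x)\<^sup>2 / 4"

definition rtilde :: "nat \<Rightarrow> real \<Rightarrow> real \<Rightarrow> real" where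
  "rtilde n \<beta> u = max ((ln (real n) / real n) powr (\<beta> / (\<beta> + 1)))
                        ((u * (ln (real n) / real n)) powr (\<beta> / (2 * \<beta> + 1)))"

end

theory Submission
  imports Defs "HOL-Real_Asymp.Real_Asymp"
begin

text \<open>Write \<open>h = 2 * sqrt f\<close>. If the noise in the coefficients stays below a fraction of the threshold,
  every thresholded coefficient has error at most a constant times the minimum of \<open>\<bar>\<theta>\<bar>\<close> and
  \<open>sqrt (log n / n)\<close>, where \<open>\<theta>\<close> is the true coefficient. Flatness of \<open>f\<close> gives, for every wavelet at
  scale \<open>s\<close> that does not vanish at \<open>x\<close>, the two bounds \<open>\<bar>\<theta>\<bar> \<le> A * s powr ((\<beta> + 1) / 2)\<close> and
  \<open>sqrt (f x) * \<bar>\<theta>\<bar> \<le> A * s powr (\<beta> + 1 / 2)\<close>. Summing the minimum over all scales bounds the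
  error \<open>E\<close> of the estimate of \<open>h x\<close> by the square root of the first branch of the rate, and
  \<open>sqrt (f x) * E\<close> by the second branch where \<open>f x\<close> is large. Finally the error for \<open>f x\<close> is at most
  \<open>E\<^sup>2 / 4 + sqrt (f x) * E\<close>.\<close>

subsection \<open>Taylor expansion\<close>

lemma Taylor_Hoelder_remainder:
  fixes D :: "nat \<Rightarrow> real \<Rightarrow> real"
  assumes T: "convex T" "x \<in> T" "t \<in> T"
    and deriv: "\<And>k y. k < m \<Longrightarrow> y \<in> T \<Longrightarrow> (D k has_real_derivative D (Suc k) y) (at y within T)"
    and Hoelder: "\<And>y. y \<in> T \<Longrightarrow> \<bar>D m y - D m x\<bar> \<le> c * \<bar>y - x\<bar> powr \<alpha>"
    and c: "0 \<le> c" and \<alpha>: "0 \<le> \<alpha>"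
  shows "\<bar>D 0 t - (\<Sum>i\<le>m. D i x / fact i * (t - x) ^ i)\<bar> \<le> c * \<bar>t - x\<bar> powr (\<alpha> + real m)"
proof (cases m)
  case 0
  then show ?thesis using Hoelder[OF T(3)] by simp
next
  case (Suc n)
  \<comment> \<open>Subtracting the top-order Taylor term turns the \<open>m\<close>-th derivative into \<open>D m y - D m x\<close>.\<close>
  define F where "F i y = D i y - D m x * (y - x) ^ (m - i) / fact (m - i)" for i y
  let ?U = "closed_segment x t"
  have sub: "?U \<subseteq> T" using T convex_contains_segment by blast
  have F_deriv: "(F i has_real_derivative F (Suc i) y) (at y within ?U)" if "y \<in> ?U" "i \<le> n" for i y
  proof -
    have "(D i has_real_derivative D (Suc i) y) (at y within ?U)"
      using deriv[of i y] that sub Suc by (auto intro: DERIV_subset)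
    moreover have "((\<lambda>y. D m x * (y - x) ^ Suc (n - i) / fact (Suc (n - i))) has_real_derivative
        D m x * (y - x) ^ (n - i) / fact (n - i)) (at y within ?U)"
      by (rule derivative_eq_intros refl | simp)+
    ultimately show ?thesis
      unfolding F_def using that Suc by (auto intro!: DERIV_diff simp: Suc_diff_le)
  qed
  have F_top: "norm (F (Suc n) y) \<le> c * \<bar>t - x\<bar> powr \<alpha>" if "y \<in> ?U" for y
  proof -
    have "\<bar>y - x\<bar> \<le> \<bar>t - x\<bar>" using that by (auto simp: closed_segment_eq_real_ivl split: if_splits)
    then have "c * \<bar>y - x\<bar> powr \<alpha> \<le> c * \<bar>t - x\<bar> powr \<alpha>"
      using c \<alpha> by (intro mult_left_mono powr_mono2) auto
    then show ?thesis using Hoelder[of y] that sub Suc by (auto simp: F_def)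
  qed
  have "norm (F 0 t - (\<Sum>i\<le>n. F i x * (t - x) ^ i / fact i))
      \<le> c * \<bar>t - x\<bar> powr \<alpha> * norm (t - x) ^ Suc n / fact n"
    by (rule field_Taylor[OF _ F_deriv F_top]) auto
  also have "F 0 t - (\<Sum>i\<le>n. F i x * (t - x) ^ i / fact i) = D 0 t - (\<Sum>i\<le>m. D i x / fact i * (t - x) ^ i)"
    using Suc by (simp add: F_def zero_power)
  also have "c * \<bar>t - x\<bar> powr \<alpha> * norm (t - x) ^ Suc n / fact n \<le> c * \<bar>t - x\<bar> powr \<alpha> * \<bar>t - x\<bar> ^ m / 1"
    unfolding Suc real_norm_def using c by (intro divide_left_mono fact_ge_1) auto
  also have "c * \<bar>t - x\<bar> powr \<alpha> * \<bar>t - x\<bar> ^ m / 1 = c * \<bar>t - x\<bar> powr (\<alpha> + real m)"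
    using Suc by (cases "t = x") (auto simp: powr_add powr_realpow)
  finally show ?thesis by simp
qed

subsection \<open>Square roots of polynomials\<close>

text \<open>Comparing coefficients in \<open>p\<^sup>2 = q\<close> with \<open>p\<^sub>0 = 1\<close> gives \<open>2 p\<^sub>i = q\<^sub>i - \<Sum>\<^sub>0\<^sub><\<^sub>a\<^sub><\<^sub>i p\<^sub>a p\<^sub>i\<^sub>-\<^sub>a\<close>, hence a
  recursive bound for the coefficients of \<open>p\<close>.\<close>

primrec sqrt_coeff_bound :: "real \<Rightarrow> nat \<Rightarrow> real" where
  "sqrt_coeff_bound K 0 = 1"
| "sqrt_coeff_bound K (Suc m) = K + real (Suc m) * (sqrt_coeff_bound K m)\<^sup>2"

lemma sqrt_coeff_bound_ge_1:
  assumes "1 \<le> K"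
  shows "1 \<le> sqrt_coeff_bound K m"
  using assms by (cases m) (auto intro: add_increasing2)

lemma sqrt_coeff_bound_mono:
  assumes K: "1 \<le> K" and "i \<le> j"
  shows "sqrt_coeff_bound K i \<le> sqrt_coeff_bound K j"
  using \<open>i \<le> j\<close>
proof (rule lift_Suc_mono_le[rotated])
  fix m
  have "sqrt_coeff_bound K m * 1 \<le> real (Suc m) * (sqrt_coeff_bound K m)\<^sup>2"
    unfolding power2_eq_square using sqrt_coeff_bound_ge_1[OF K, of m]
    by (subst mult.left_commute, intro mult_left_mono) (auto simp: mult_ge1_I)
  then show "sqrt_coeff_bound K m \<le> sqrt_coeff_bound K (Suc m)" using K by simp
qed

lemma fps_sqrt_coeff_le:
  fixes p :: "real fps"
  assumes K: "1 \<le> K" and p0: "fps_nth p 0 = 1"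
    and square: "\<And>i. i \<le> n \<Longrightarrow> \<bar>fps_nth (p\<^sup>2) i\<bar> \<le> K"
  shows "i \<le> n \<Longrightarrow> \<bar>fps_nth p i\<bar> \<le> sqrt_coeff_bound K i"
proof (induction i rule: less_induct)
  case (less i)
  show ?case
  proof (cases i)
    case 0
    then show ?thesis using p0 by simp
  next
    case (Suc m)
    let ?b = "sqrt_coeff_bound K m"
    have inner: "\<bar>\<Sum>a\<in>{1..m}. fps_nth p a * fps_nth p (i - a)\<bar> \<le> (\<Sum>a\<in>{1..m}. ?b\<^sup>2)"
    proof (rule order_trans[OF sum_abs sum_mono])
      fix a assume "a \<in> {1..m}"
      then have "\<bar>fps_nth p a\<bar> \<le> ?b" "\<bar>fps_nth p (i - a)\<bar> \<le> ?b"
        using less Suc by (auto intro!: order_trans[OF less.IH sqrt_coeff_bound_mono[OF K]])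
      then show "\<bar>fps_nth p a * fps_nth p (i - a)\<bar> \<le> ?b\<^sup>2"
        by (simp add: abs_mult power2_eq_square mult_mono')
    qed
    have "{0..i} = insert 0 (insert i {1..m})" using Suc by auto
    then have "fps_nth (p\<^sup>2) i = 2 * fps_nth p i + (\<Sum>a\<in>{1..m}. fps_nth p a * fps_nth p (i - a))"
      using Suc p0 by (simp add: power2_eq_square fps_mult_nth)
    then have "2 * \<bar>fps_nth p i\<bar> \<le> K + real m * ?b\<^sup>2"
      using square[of i] inner less.prems by simp
    then have "\<bar>fps_nth p i\<bar> \<le> K + real m * ?b\<^sup>2" by linarith
    also have "\<dots> \<le> sqrt_coeff_bound K i" using Suc by (simp add: distrib_right)
    finally show ?thesis .
  qed
qed

lemma square_truncation_error:
  fixes p :: "nat \<Rightarrow> real"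
  assumes B: "\<And>i. i < n \<Longrightarrow> \<bar>p i\<bar> \<le> B" and s: "\<bar>s\<bar> \<le> 1"
  shows "\<bar>(\<Sum>i<n. p i * s ^ i)\<^sup>2 - (\<Sum>r<n. (\<Sum>a\<le>r. p a * p (r - a)) * s ^ r)\<bar> \<le> (real n * B)\<^sup>2 * \<bar>s\<bar> ^ n"
proof -
  let ?term = "\<lambda>(i, j). (p i * s ^ i) * (p j * s ^ j)"
  let ?square = "{..<n} \<times> {..<n}" and ?low = "{(i, j). i + j < n}"
  have low_sub: "?low \<subseteq> ?square" by auto
  have "(\<Sum>r<n. (\<Sum>a\<le>r. p a * p (r - a)) * s ^ r) = (\<Sum>r<n. \<Sum>a\<le>r. (p a * s ^ a) * (p (r - a) * s ^ (r - a)))"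
    by (auto simp: sum_distrib_left sum_distrib_right mult_ac simp flip: power_add intro!: sum.cong)
  also have "\<dots> = sum ?term ?low" by (rule sum.triangle_reindex[symmetric])
  finally have "(\<Sum>i<n. p i * s ^ i)\<^sup>2 - (\<Sum>r<n. (\<Sum>a\<le>r. p a * p (r - a)) * s ^ r) = sum ?term (?square - ?low)"
    using low_sub by (simp add: power2_eq_square sum_product sum.cartesian_product sum_diff)
  also have "\<bar>\<dots>\<bar> \<le> (\<Sum>_\<in>?square - ?low. B\<^sup>2 * \<bar>s\<bar> ^ n)"
  proof (rule order_trans[OF sum_abs sum_mono])
    fix ij assume "ij \<in> ?square - ?low"
    then obtain i j where ij: "ij = (i, j)" "i < n" "j < n" "n \<le> i + j" by force
    have "\<bar>p i * p j\<bar> \<le> B * B" using B ij by (simp add: abs_mult mult_mono')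
    moreover have "\<bar>s ^ (i + j)\<bar> \<le> \<bar>s\<bar> ^ n" using ij s by (simp add: power_abs power_decreasing)
    ultimately have "\<bar>p i * p j\<bar> * \<bar>s ^ (i + j)\<bar> \<le> (B * B) * \<bar>s\<bar> ^ n" by (intro mult_mono) auto
    then show "\<bar>?term ij\<bar> \<le> B\<^sup>2 * \<bar>s\<bar> ^ n"
      by (simp add: ij abs_mult power_add power2_eq_square mult_ac)
  qed
  also have "\<dots> = real (card (?square - ?low)) * (B\<^sup>2 * \<bar>s\<bar> ^ n)" by simp
  also have "\<dots> \<le> real (card ?square) * (B\<^sup>2 * \<bar>s\<bar> ^ n)"
    by (intro mult_right_mono of_nat_mono card_mono) auto
  finally show ?thesis by (simp add: power_mult_distrib power2_eq_square mult_ac)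
qed

lemma polynomial_ge_half:
  fixes p :: "nat \<Rightarrow> real"
  assumes p0: "p 0 = 1" and B: "\<And>i. i < n \<Longrightarrow> \<bar>p i\<bar> \<le> B"
    and n: "0 < n" and s: "\<bar>s\<bar> \<le> 1" "2 * real n * B * \<bar>s\<bar> \<le> 1"
  shows "1 / 2 \<le> (\<Sum>i<n. p i * s ^ i)"
proof -
  have "0 \<le> B" using B[OF n] p0 by simp
  have "\<bar>\<Sum>i\<in>{1..<n}. p i * s ^ i\<bar> \<le> (\<Sum>i\<in>{1..<n}. B * \<bar>s\<bar>)"
  proof (rule order_trans[OF sum_abs sum_mono])
    fix i assume i: "i \<in> {1..<n}"
    then have "\<bar>s\<bar> ^ i \<le> \<bar>s\<bar> ^ 1" using s by (intro power_decreasing) auto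
    then show "\<bar>p i * s ^ i\<bar> \<le> B * \<bar>s\<bar>" using B[of i] i by (simp add: abs_mult power_abs mult_mono')
  qed
  also have "\<dots> = real (n - 1) * (B * \<bar>s\<bar>)" by simp
  also have "\<dots> \<le> real n * (B * \<bar>s\<bar>)" using \<open>0 \<le> B\<close> by (intro mult_right_mono) auto
  also have "\<dots> \<le> 1 / 2" using s by (simp add: mult_ac)
  finally have "\<bar>\<Sum>i\<in>{1..<n}. p i * s ^ i\<bar> \<le> 1 / 2" .
  moreover have "{..<n} = insert 0 {1..<n}" using n by auto
  ultimately show ?thesis using p0 by simp
qed

definition sqrt_approx_const :: "nat \<Rightarrow> real \<Rightarrow> real" where
  "sqrt_approx_const n K = (2 * real n * sqrt_coeff_bound K n)\<^sup>2"

lemma sqrt_approx_const_ge: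
  assumes "1 \<le> K" "0 < n"
  shows "4 * K \<le> sqrt_approx_const n K"
proof -
  let ?b = "sqrt_coeff_bound K n"
  obtain m where "n = Suc m" using assms(2) gr0_conv_Suc by blast
  then have b: "K \<le> ?b" by (simp add: mult_nonneg_nonneg)
  have "4 * (1 * (K * 1)) \<le> 4 * ((real n)\<^sup>2 * (?b * ?b))"
    using assms b by (intro mult_left_mono mult_mono) (auto simp: one_le_power)
  then show ?thesis by (simp add: sqrt_approx_const_def power2_eq_square mult_ac)
qed

lemma polynomial_sqrt_approx:
  fixes q :: "nat \<Rightarrow> real"
  assumes K: "1 \<le> K" and n: "0 < n" and q0: "q 0 = 1" and q: "\<And>i. i < n \<Longrightarrow> \<bar>q i\<bar> \<le> K"
  obtains p where "\<And>s. sqrt_approx_const n K * \<bar>s\<bar> \<le> 1 \<Longrightarrow> 1 / 2 \<le> (\<Sum>i<n. p i * s ^ i)"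
    "\<And>s. sqrt_approx_const n K * \<bar>s\<bar> \<le> 1 \<Longrightarrow>
      \<bar>(\<Sum>i<n. p i * s ^ i)\<^sup>2 - (\<Sum>i<n. q i * s ^ i)\<bar> \<le> sqrt_approx_const n K * \<bar>s\<bar> ^ n"
proof -
  define P where "P = fps_radical (\<lambda>_ _. 1) 2 (Abs_fps q)"
  have P_constant: "fps_nth P 0 = 1" by (simp add: P_def)
  have P_square: "P\<^sup>2 = Abs_fps q"
    using power_radical[of "Abs_fps q" "\<lambda>_ _. 1" 1] q0 by (simp add: P_def numeral_2_eq_2)
  let ?b = "sqrt_coeff_bound K n"
  have b: "\<bar>fps_nth P i\<bar> \<le> ?b" if "i < n" for i
  proof -
    have "\<bar>fps_nth P i\<bar> \<le> sqrt_coeff_bound K i"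
      by (rule fps_sqrt_coeff_le[OF K P_constant, of "n - 1"]) (use q that in \<open>auto simp: P_square\<close>)
    also have "\<dots> \<le> ?b" using sqrt_coeff_bound_mono[OF K] that by simp
    finally show ?thesis .
  qed
  let ?C = "sqrt_approx_const n K"
  have b_ge_1: "1 \<le> ?b" by (rule sqrt_coeff_bound_ge_1[OF K])
  have nb_ge_1: "1 \<le> 2 * real n * ?b" using n mult_mono[of 1 "2 * real n" 1 ?b] b_ge_1 by simp
  have C_ge_1: "1 \<le> ?C" unfolding sqrt_approx_const_def by (rule one_le_power[OF nb_ge_1])
  have C: "2 * real n * ?b \<le> ?C" "(real n * ?b)\<^sup>2 \<le> ?C"
    using mult_left_mono[OF nb_ge_1, of "2 * real n * ?b"] nb_ge_1
    by (auto simp: sqrt_approx_const_def power2_eq_square)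
  have P_convolution: "(\<Sum>a\<le>r. fps_nth P a * fps_nth P (r - a)) = q r" for r
    using arg_cong[OF P_square, of "\<lambda>F. fps_nth F r"]
    by (simp add: power2_eq_square fps_mult_nth atLeast0AtMost)
  show thesis
  proof (rule that[of "fps_nth P"])
    fix s assume s: "?C * \<bar>s\<bar> \<le> 1"
    then have s_le_1: "\<bar>s\<bar> \<le> 1" using mult_right_mono[OF C_ge_1, of "\<bar>s\<bar>"] by simp
    show "1 / 2 \<le> (\<Sum>i<n. fps_nth P i * s ^ i)"
      by (rule polynomial_ge_half[of "fps_nth P", OF P_constant b n s_le_1])
        (use mult_right_mono[OF C(1), of "\<bar>s\<bar>"] s in auto)
    have "\<bar>(\<Sum>i<n. fps_nth P i * s ^ i)\<^sup>2 - (\<Sum>i<n. q i * s ^ i)\<bar> \<le> (real n * ?b)\<^sup>2 * \<bar>s\<bar> ^ n"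
      using square_truncation_error[of n "fps_nth P", OF b s_le_1] by (simp add: P_convolution)
    also have "\<dots> \<le> ?C * \<bar>s\<bar> ^ n" using C(2) by (intro mult_right_mono) auto
    finally show "\<bar>(\<Sum>i<n. fps_nth P i * s ^ i)\<^sup>2 - (\<Sum>i<n. q i * s ^ i)\<bar> \<le> ?C * \<bar>s\<bar> ^ n" .
  qed
qed

subsection \<open>Flat Hoelder functions and their square roots\<close>

lemma lfloor_bounds:
  assumes "0 < \<beta>"
  shows "real (lfloor \<beta>) < \<beta>" "\<beta> \<le> real (lfloor \<beta>) + 1"
proof -
  have "1 \<le> \<lceil>\<beta>\<rceil>" using assms by simp
  then have "real (lfloor \<beta>) = of_int \<lceil>\<beta>\<rceil> - 1" unfolding lfloor_def by simp
  then show "real (lfloor \<beta>) < \<beta>" "\<beta> \<le> real (lfloor \<beta>) + 1" by linarith+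
qed

text \<open>At height \<open>f x\<close> the natural length scale is \<open>f x powr (1 / \<beta>)\<close>: on it every term of the local
  expansion is of order \<open>f x\<close>. The terms of order at least \<open>\<beta>\<close> must vanish, so that the
  coefficients stay controlled where \<open>f\<close> is small.\<close>

locale flat_Hoelder =
  fixes S :: nat and \<beta> K :: real and f :: "real \<Rightarrow> real"
  assumes exponent_pos: "0 < \<beta>" and exponent_less: "\<beta> < real S" and K_ge_1: "1 \<le> K"
    and nonneg: "\<And>x. x \<in> {0..1} \<Longrightarrow> 0 \<le> f x"
    and length_scale_le: "\<And>x. x \<in> {0..1} \<Longrightarrow> f x powr (1 / \<beta>) \<le> K"
    and expansion: "\<And>x. x \<in> {0..1} \<Longrightarrow> \<exists>d. d 0 = f x \<and> (\<forall>i<S. \<beta> \<le> real i \<longrightarrow> d i = 0) \<and>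
      (\<forall>i<S. \<bar>d i\<bar> \<le> K * f x powr (1 - real i / \<beta>)) \<and>
      (\<forall>t\<in>{0..1}. \<bar>f t - (\<Sum>i<S. d i * (t - x) ^ i)\<bar> \<le> K * \<bar>t - x\<bar> powr \<beta>)"

lemma flat_HoelderI:
  fixes D :: "nat \<Rightarrow> real \<Rightarrow> real"
  assumes \<beta>: "0 < \<beta>" "\<beta> < real S" "real m < \<beta>" "\<beta> \<le> real m + 1" and K: "1 \<le> K"
    and "\<And>x. x \<in> {0..1} \<Longrightarrow> 0 \<le> f x" "\<And>x. x \<in> {0..1} \<Longrightarrow> f x powr (1 / \<beta>) \<le> K"
    and D0: "\<And>x. x \<in> {0..1} \<Longrightarrow> D 0 x = f x"
    and deriv: "\<And>k x. k < m \<Longrightarrow> x \<in> {0..1} \<Longrightarrow> (D k has_real_derivative D (Suc k) x) (at x within {0..1})"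
    and Hoelder: "\<And>x y. x \<in> {0..1} \<Longrightarrow> y \<in> {0..1} \<Longrightarrow> \<bar>D m x - D m y\<bar> \<le> K * \<bar>x - y\<bar> powr (\<beta> - real m)"
    and flat: "\<And>i x. i \<le> m \<Longrightarrow> x \<in> {0..1} \<Longrightarrow> \<bar>D i x\<bar> \<le> K * f x powr (1 - real i / \<beta>)"
  shows "flat_Hoelder S \<beta> K f"
proof
  fix x :: real assume x: "x \<in> {0..1}"
  define d where "d i = (if i \<le> m then D i x / fact i else 0)" for i
  have "\<bar>d i\<bar> \<le> K * f x powr (1 - real i / \<beta>)" for i
  proof (cases "i \<le> m")
    case True
    then have "\<bar>d i\<bar> = \<bar>D i x\<bar> / fact i" by (simp add: d_def)
    also have "\<dots> \<le> \<bar>D i x\<bar> / 1" by (intro divide_left_mono fact_ge_1) auto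
    also have "\<dots> \<le> K * f x powr (1 - real i / \<beta>)" using flat[OF True x] by simp
    finally show ?thesis .
  qed (use K in \<open>simp add: d_def\<close>)
  moreover have "\<bar>f t - (\<Sum>i<S. d i * (t - x) ^ i)\<bar> \<le> K * \<bar>t - x\<bar> powr \<beta>" if t: "t \<in> {0..1}" for t
  proof -
    have "(\<Sum>i<S. d i * (t - x) ^ i) = (\<Sum>i\<le>m. d i * (t - x) ^ i)"
      using \<beta> by (intro sum.mono_neutral_right) (auto simp: d_def)
    also have "\<dots> = (\<Sum>i\<le>m. D i x / fact i * (t - x) ^ i)"
      by (intro sum.cong) (auto simp: d_def)
    finally show ?thesis
      using Taylor_Hoelder_remainder[OF _ x t deriv Hoelder[OF _ x]] K \<beta> D0[OF t] by simp
  qed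
  moreover have "d 0 = f x" "\<And>i. \<beta> \<le> real i \<Longrightarrow> d i = 0" using D0[OF x] \<beta> by (auto simp: d_def)
  ultimately show "\<exists>d. d 0 = f x \<and> (\<forall>i<S. \<beta> \<le> real i \<longrightarrow> d i = 0) \<and>
      (\<forall>i<S. \<bar>d i\<bar> \<le> K * f x powr (1 - real i / \<beta>)) \<and>
      (\<forall>t\<in>{0..1}. \<bar>f t - (\<Sum>i<S. d i * (t - x) ^ i)\<bar> \<le> K * \<bar>t - x\<bar> powr \<beta>)"
    by blast
qed (use assms in auto)

lemma H_ballE:
  assumes "H_ball \<beta> R f"
  obtains D where
    "\<And>k x. k < lfloor \<beta> \<Longrightarrow> x \<in> {0..1} \<Longrightarrow> (D k has_real_derivative D (Suc k) x) (at x within {0..1})"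
    "\<And>x y. x \<in> {0..1} \<Longrightarrow> y \<in> {0..1} \<Longrightarrow>
      \<bar>D (lfloor \<beta>) x - D (lfloor \<beta>) y\<bar> \<le> R * \<bar>x - y\<bar> powr (\<beta> - real (lfloor \<beta>))"
    "\<And>j x. 1 \<le> j \<Longrightarrow> real j < \<beta> \<Longrightarrow> x \<in> {0..1} \<Longrightarrow> \<bar>D j x\<bar> powr \<beta> \<le> R ^ j * f x powr (\<beta> - real j)"
    "\<And>x. x \<in> {0..1} \<Longrightarrow> D 0 x = f x"
    "\<And>x. x \<in> {0..1} \<Longrightarrow> 0 \<le> f x" "\<And>x. x \<in> {0..1} \<Longrightarrow> f x \<le> R" "0 \<le> R"
proof -
  let ?m = "lfloor \<beta>"
  from assms obtain D a b c d where nonneg: "\<forall>x\<in>{0..1}. 0 \<le> f x" and D0: "\<forall>x\<in>{0..1}. D 0 x = f x"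
    and deriv: "\<forall>k<?m. \<forall>x\<in>{0..1}. (D k has_real_derivative D (Suc k) x) (at x within {0..1})"
    and a: "\<forall>x\<in>{0..1}. \<bar>f x\<bar> \<le> a" and b: "\<forall>x\<in>{0..1}. \<bar>D ?m x\<bar> \<le> b"
    and c: "\<forall>x\<in>{0..1}. \<forall>y\<in>{0..1}. x \<noteq> y \<longrightarrow> \<bar>D ?m x - D ?m y\<bar> \<le> c * \<bar>x - y\<bar> powr (\<beta> - real ?m)"
    and d: "0 \<le> d" "\<forall>j::nat. 1 \<le> j \<and> real j < \<beta> \<longrightarrow>
      (\<forall>x\<in>{0..1}. \<bar>D j x\<bar> powr \<beta> \<le> d ^ j * \<bar>f x\<bar> powr (\<beta> - real j))"
    and sum: "a + b + c + d \<le> R"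
    unfolding H_ball_def by blast
  have "0 \<le> a" "0 \<le> b" "0 \<le> c" using a[rule_format, of 0] b[rule_format, of 0] c[rule_format, of 0 1] by auto
  then have R: "a \<le> R" "c \<le> R" "d \<le> R" "0 \<le> R" using sum d(1) by linarith+
  show thesis
  proof (rule that[of D])
    fix x y :: real assume xy: "x \<in> {0..1}" "y \<in> {0..1}"
    show "\<bar>D ?m x - D ?m y\<bar> \<le> R * \<bar>x - y\<bar> powr (\<beta> - real ?m)"
      using c[rule_format, OF xy] mult_right_mono[OF R(2), of "\<bar>x - y\<bar> powr (\<beta> - real ?m)"] by force
  next
    fix j :: nat and x :: real assume j: "1 \<le> j" "real j < \<beta>" and x: "x \<in> {0..1}"
    have "d ^ j * \<bar>f x\<bar> powr (\<beta> - real j) \<le> R ^ j * f x powr (\<beta> - real j)"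
      using nonneg x d(1) R by (auto intro!: mult_right_mono power_mono)
    then show "\<bar>D j x\<bar> powr \<beta> \<le> R ^ j * f x powr (\<beta> - real j)"
      using d(2)[rule_format, OF conjI[OF j] x] by linarith
  qed (use D0 deriv nonneg a R in \<open>auto intro: order_trans\<close>)
qed

definition flat_const :: "nat \<Rightarrow> real \<Rightarrow> real \<Rightarrow> real" where
  "flat_const S \<beta>1 R2 = max 1 R2 powr (real S / \<beta>1)"

lemma powr_le_flat_const:
  assumes "0 \<le> R" "R \<le> R2" "0 < \<beta>1" "0 \<le> p" "p \<le> real S / \<beta>1"
  shows "R powr p \<le> flat_const S \<beta>1 R2"
proof -
  have "R powr p \<le> max 1 R2 powr p" using assms by (intro powr_mono2) auto
  also have "\<dots> \<le> flat_const S \<beta>1 R2" unfolding flat_const_def using assms by (intro powr_mono) auto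
  finally show ?thesis .
qed

lemma root_of_powr_le:
  fixes a R u \<beta> :: real
  assumes \<beta>: "0 < \<beta>" and R: "0 \<le> R" and "1 \<le> i" "0 \<le> a"
    and le: "a powr \<beta> \<le> R ^ i * u powr (\<beta> - real i)"
  shows "a \<le> R powr (real i / \<beta>) * u powr (1 - real i / \<beta>)"
proof -
  have "a = (a powr \<beta>) powr (1 / \<beta>)" using \<beta> \<open>0 \<le> a\<close> by (simp add: powr_powr)
  also have "\<dots> \<le> (R ^ i * u powr (\<beta> - real i)) powr (1 / \<beta>)"
    using le \<beta> by (intro powr_mono2) auto
  also have "\<dots> = R powr (real i / \<beta>) * u powr (1 - real i / \<beta>)"
    using R \<beta> \<open>1 \<le> i\<close> by (simp add: powr_mult powr_powr powr_realpow'[symmetric] diff_divide_distrib)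
  finally show ?thesis .
qed

lemma H_ball_imp_flat_Hoelder:
  assumes H: "H_ball \<beta> R f" and R2: "R \<le> R2" and \<beta>: "0 < \<beta>1" "\<beta>1 \<le> \<beta>" "\<beta> < real S"
  shows "flat_Hoelder S \<beta> (flat_const S \<beta>1 R2) f"
proof -
  let ?m = "lfloor \<beta>" and ?K = "flat_const S \<beta>1 R2"
  have \<beta>_pos: "0 < \<beta>" using \<beta> by linarith
  note m = lfloor_bounds[OF \<beta>_pos]
  obtain D where deriv: "\<And>k x. k < ?m \<Longrightarrow> x \<in> {0..1} \<Longrightarrow> (D k has_real_derivative D (Suc k) x) (at x within {0..1})"
    and Hoelder: "\<And>x y. x \<in> {0..1} \<Longrightarrow> y \<in> {0..1} \<Longrightarrow> \<bar>D ?m x - D ?m y\<bar> \<le> R * \<bar>x - y\<bar> powr (\<beta> - real ?m)"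
    and flat: "\<And>j x. 1 \<le> j \<Longrightarrow> real j < \<beta> \<Longrightarrow> x \<in> {0..1} \<Longrightarrow> \<bar>D j x\<bar> powr \<beta> \<le> R ^ j * f x powr (\<beta> - real j)"
    and D0: "\<And>x. x \<in> {0..1} \<Longrightarrow> D 0 x = f x"
    and f: "\<And>x. x \<in> {0..1} \<Longrightarrow> 0 \<le> f x" "\<And>x. x \<in> {0..1} \<Longrightarrow> f x \<le> R" and R: "0 \<le> R"
    using H_ballE[OF H] by blast
  note K_bound = powr_le_flat_const[OF R R2 \<beta>(1)]
  have K: "1 \<le> ?K" unfolding flat_const_def using \<beta> by (intro ge_one_powr_ge_zero) auto
  have R_le_K: "R \<le> ?K" using K_bound[of 1 S] R \<beta> by simp
  show ?thesis
  proof (rule flat_HoelderI[where m = ?m and D = D])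
    fix x :: real assume x: "x \<in> {0..1}"
    have "f x powr (1 / \<beta>) \<le> R powr (1 / \<beta>)" using f[OF x] \<beta>_pos by (intro powr_mono2) auto
    also have "\<dots> \<le> ?K" using \<beta> by (intro K_bound frac_le) auto
    finally show "f x powr (1 / \<beta>) \<le> ?K" .
    fix i assume i: "i \<le> ?m"
    show "\<bar>D i x\<bar> \<le> ?K * f x powr (1 - real i / \<beta>)"
    proof (cases "i = 0")
      case True
      then show ?thesis using D0[OF x] f(1)[OF x] mult_right_mono[OF K, of "f x"] by simp
    next
      case False
      have "\<bar>D i x\<bar> \<le> R powr (real i / \<beta>) * f x powr (1 - real i / \<beta>)"
        using flat[of i x] False i m x by (intro root_of_powr_le \<beta>_pos R) auto
      also have "\<dots> \<le> ?K * f x powr (1 - real i / \<beta>)"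
        using i m \<beta> by (intro mult_right_mono K_bound frac_le) auto
      finally show ?thesis .
    qed
  next
    fix x y :: real assume "x \<in> {0..1}" "y \<in> {0..1}"
    then show "\<bar>D ?m x - D ?m y\<bar> \<le> ?K * \<bar>x - y\<bar> powr (\<beta> - real ?m)"
      using Hoelder mult_right_mono[OF R_le_K, of "\<bar>x - y\<bar> powr (\<beta> - real ?m)"] by force
  qed (use deriv D0 f \<beta> m K \<beta>_pos in auto)
qed

lemma abs_sqrt_diff_le:
  assumes "0 \<le> u" "0 < a" "a \<le> p"
  shows "a * \<bar>sqrt u - p\<bar> \<le> \<bar>u - p\<^sup>2\<bar>"
proof -
  have "a * \<bar>sqrt u - p\<bar> \<le> \<bar>sqrt u + p\<bar> * \<bar>sqrt u - p\<bar>"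
    using assms by (intro mult_right_mono) (auto intro: add_increasing)
  also have "\<dots> = \<bar>u - p\<^sup>2\<bar>"
    using assms(1) unfolding abs_mult[symmetric] by (simp add: algebra_simps power2_eq_square)
  finally show ?thesis .
qed

context flat_Hoelder
begin

lemma degree_pos: "0 < S"
  using exponent_pos exponent_less by (cases S) auto

lemma continuous_f: "continuous_on {0..1} f"
  unfolding continuous_on_def
proof
  fix x :: real assume x: "x \<in> {0..1}"
  obtain d where d: "d 0 = f x"
    "\<And>t. t \<in> {0..1} \<Longrightarrow> \<bar>f t - (\<Sum>i<S. d i * (t - x) ^ i)\<bar> \<le> K * \<bar>t - x\<bar> powr \<beta>"
    using expansion[OF x] by blast
  let ?P = "\<lambda>t. \<Sum>i<S. d i * (t - x) ^ i"
  have "((\<lambda>t. K * \<bar>t - x\<bar> powr \<beta>) \<longlongrightarrow> K * \<bar>x - x\<bar> powr \<beta>) (at x within {0..1})"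
    using exponent_pos by (intro tendsto_intros tendsto_powr2) auto
  then have "((\<lambda>t. K * \<bar>t - x\<bar> powr \<beta>) \<longlongrightarrow> 0) (at x within {0..1})" by simp
  then have "((\<lambda>t. f t - ?P t) \<longlongrightarrow> 0) (at x within {0..1})"
    by (rule Lim_null_comparison[rotated]) (use d(2) in \<open>auto simp: eventually_at_filter\<close>)
  moreover have "(?P \<longlongrightarrow> ?P x) (at x within {0..1})"
    by (intro tendsto_intros)
  ultimately have "((\<lambda>t. f t - ?P t + ?P t) \<longlongrightarrow> 0 + ?P x) (at x within {0..1})"
    by (rule tendsto_add)
  moreover have "?P x = f x"
    using degree_pos d(1) by (simp add: power_0_left if_distrib cong: if_cong)
  ultimately show "(f \<longlongrightarrow> f x) (at x within {0..1})" by simp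
qed

lemma continuous_sqrt: "continuous_on {0..1} (\<lambda>t. sqrt (f t))"
  by (intro continuous_intros continuous_f)

lemma local_upper_bound:
  assumes x: "x \<in> {0..1}" and t: "t \<in> {0..1}" and r: "0 < r" "\<bar>t - x\<bar> \<le> r" "f x \<le> r powr \<beta>"
  shows "f t \<le> (real S + 1) * K * r powr \<beta>"
proof -
  obtain d where d: "\<And>i. i < S \<Longrightarrow> \<beta> \<le> real i \<Longrightarrow> d i = 0"
    "\<And>i. i < S \<Longrightarrow> \<bar>d i\<bar> \<le> K * f x powr (1 - real i / \<beta>)"
    "\<bar>f t - (\<Sum>i<S. d i * (t - x) ^ i)\<bar> \<le> K * \<bar>t - x\<bar> powr \<beta>"
    using expansion[OF x] t by blast
  have "\<bar>\<Sum>i<S. d i * (t - x) ^ i\<bar> \<le> (\<Sum>i<S. K * r powr \<beta>)"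
  proof (rule order_trans[OF sum_abs sum_mono])
    fix i assume "i \<in> {..<S}"
    then have i: "i < S" by simp
    show "\<bar>d i * (t - x) ^ i\<bar> \<le> K * r powr \<beta>"
    proof (cases "\<beta> \<le> real i")
      case False
      have "\<bar>d i\<bar> \<le> K * f x powr (1 - real i / \<beta>)" by (rule d(2)[OF i])
      also have "\<dots> \<le> K * (r powr \<beta>) powr (1 - real i / \<beta>)"
        using False exponent_pos r nonneg[OF x] K_ge_1 by (intro mult_left_mono powr_mono2) auto
      also have "\<dots> = K * r powr (\<beta> - real i)" using exponent_pos by (simp add: powr_powr algebra_simps)
      finally have "\<bar>d i\<bar> \<le> K * r powr (\<beta> - real i)" .
      moreover have "\<bar>(t - x) ^ i\<bar> \<le> r powr real i"
        using r by (simp add: power_abs powr_realpow power_mono)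
      ultimately have "\<bar>d i * (t - x) ^ i\<bar> \<le> (K * r powr (\<beta> - real i)) * r powr real i"
        unfolding abs_mult by (intro mult_mono) auto
      then show ?thesis using r by (simp add: powr_diff)
    qed (use d(1)[OF i] K_ge_1 in auto)
  qed
  moreover have "K * \<bar>t - x\<bar> powr \<beta> \<le> K * r powr \<beta>"
    using r exponent_pos K_ge_1 by (intro mult_left_mono powr_mono2) auto
  ultimately show ?thesis using d(3) by (simp add: algebra_simps)
qed

lemma sqrt_local_upper_bound:
  assumes "x \<in> {0..1}" "t \<in> {0..1}" "0 < r" "\<bar>t - x\<bar> \<le> r" "f x \<le> r powr \<beta>"
  shows "sqrt (f t) \<le> (real S + 1) * K * r powr (\<beta> / 2)"
proof -
  have SK_ge_1: "1 \<le> (real S + 1) * K" using K_ge_1 mult_mono[of 1 "real S + 1" 1 K] by simp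
  have "f t \<le> ((real S + 1) * K) * r powr \<beta>" using local_upper_bound[OF assms] by simp
  also have "\<dots> \<le> ((real S + 1) * K) * ((real S + 1) * K) * r powr \<beta>"
    using mult_left_mono[OF SK_ge_1, of "(real S + 1) * K"] SK_ge_1 by (intro mult_right_mono) auto
  also have "\<dots> = ((real S + 1) * K * r powr (\<beta> / 2))\<^sup>2"
    by (simp add: power_mult_distrib power2_eq_square powr_add[symmetric] mult_ac)
  finally show ?thesis using SK_ge_1 by (simp add: real_le_lsqrt)
qed

lemma normalised_expansion:
  assumes x: "x \<in> {0..1}" and fx: "0 < f x"
  obtains q where "q 0 = 1" "\<And>i. i < S \<Longrightarrow> \<bar>q i\<bar> \<le> K"
    "\<And>t. t \<in> {0..1} \<Longrightarrow>
      \<bar>f t / f x - (\<Sum>i<S. q i * ((t - x) / f x powr (1 / \<beta>)) ^ i)\<bar> \<le> K * \<bar>t - x\<bar> powr \<beta> / f x"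
proof -
  define \<rho> where "\<rho> = f x powr (1 / \<beta>)"
  have \<rho>: "0 < \<rho>" using fx by (simp add: \<rho>_def)
  obtain d where d: "d 0 = f x" "\<And>i. i < S \<Longrightarrow> \<bar>d i\<bar> \<le> K * f x powr (1 - real i / \<beta>)"
    "\<And>t. t \<in> {0..1} \<Longrightarrow> \<bar>f t - (\<Sum>i<S. d i * (t - x) ^ i)\<bar> \<le> K * \<bar>t - x\<bar> powr \<beta>"
    using expansion[OF x] by blast
  show thesis
  proof (rule that[of "\<lambda>i. d i * \<rho> ^ i / f x"])
    fix i assume i: "i < S"
    have "\<rho> ^ i = f x powr (real i / \<beta>)"
      using fx \<rho> by (simp add: powr_realpow[symmetric] \<rho>_def powr_powr)
    then have "f x powr (1 - real i / \<beta>) * \<rho> ^ i = f x" using fx by (simp add: powr_diff)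
    then have "\<bar>d i\<bar> * \<rho> ^ i \<le> K * f x"
      using mult_right_mono[OF d(2)[OF i], of "\<rho> ^ i"] \<rho> by (simp add: mult.assoc)
    then show "\<bar>d i * \<rho> ^ i / f x\<bar> \<le> K" using fx \<rho> by (simp add: abs_mult divide_le_eq)
  next
    fix t :: real assume t: "t \<in> {0..1}"
    have "(\<Sum>i<S. d i * \<rho> ^ i / f x * ((t - x) / \<rho>) ^ i) = (\<Sum>i<S. d i * (t - x) ^ i) / f x"
      unfolding sum_divide_distrib using \<rho> by (intro sum.cong) (auto simp: power_divide)
    then have "\<bar>f t / f x - (\<Sum>i<S. d i * \<rho> ^ i / f x * ((t - x) / \<rho>) ^ i)\<bar>
        = \<bar>f t - (\<Sum>i<S. d i * (t - x) ^ i)\<bar> / f x"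
      using fx by (simp add: diff_divide_distrib[symmetric])
    also have "\<dots> \<le> K * \<bar>t - x\<bar> powr \<beta> / f x"
      using d(3)[OF t] fx by (simp add: divide_right_mono)
    finally show "\<bar>f t / f x - (\<Sum>i<S. d i * \<rho> ^ i / f x * ((t - x) / f x powr (1 / \<beta>)) ^ i)\<bar>
        \<le> K * \<bar>t - x\<bar> powr \<beta> / f x" unfolding \<rho>_def .
  qed (use d(1) fx in simp)
qed

lemma normalised_square_approx:
  assumes x: "x \<in> {0..1}" and fx: "0 < f x" and r: "0 < r"
    and scale: "sqrt_approx_const S K * r \<le> f x powr (1 / \<beta>)"
  obtains p where
    "\<And>t. \<bar>t - x\<bar> \<le> r \<Longrightarrow> 1 / 2 \<le> (\<Sum>i<S. p i * ((t - x) / f x powr (1 / \<beta>)) ^ i)"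
    "\<And>t. t \<in> {0..1} \<Longrightarrow> \<bar>t - x\<bar> \<le> r \<Longrightarrow>
      \<bar>f t / f x - (\<Sum>i<S. p i * ((t - x) / f x powr (1 / \<beta>)) ^ i)\<^sup>2\<bar>
        \<le> 2 * sqrt_approx_const S K * (r powr \<beta> / f x)"
proof -
  let ?C = "sqrt_approx_const S K"
  have C: "4 * K \<le> ?C" by (rule sqrt_approx_const_ge[OF K_ge_1 degree_pos])
  define \<rho> where "\<rho> = f x powr (1 / \<beta>)"
  have \<rho>: "0 < \<rho>" "\<rho> powr \<beta> = f x" using fx exponent_pos by (auto simp: \<rho>_def powr_powr)
  obtain q where q: "q 0 = 1" "\<And>i. i < S \<Longrightarrow> \<bar>q i\<bar> \<le> K" and f_approx: "\<And>t. t \<in> {0..1} \<Longrightarrow>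
      \<bar>f t / f x - (\<Sum>i<S. q i * ((t - x) / \<rho>) ^ i)\<bar> \<le> K * \<bar>t - x\<bar> powr \<beta> / f x"
    using normalised_expansion[OF x fx] unfolding \<rho>_def by blast
  obtain p where p: "\<And>s. ?C * \<bar>s\<bar> \<le> 1 \<Longrightarrow> 1 / 2 \<le> (\<Sum>i<S. p i * s ^ i)"
    and p_square: "\<And>s. ?C * \<bar>s\<bar> \<le> 1 \<Longrightarrow> \<bar>(\<Sum>i<S. p i * s ^ i)\<^sup>2 - (\<Sum>i<S. q i * s ^ i)\<bar> \<le> ?C * \<bar>s\<bar> ^ S"
    using polynomial_sqrt_approx[of K S q, OF K_ge_1 degree_pos q] by blast
  have radius_small: "?C * (r / \<rho>) \<le> 1" using scale \<rho> by (simp add: \<rho>_def divide_le_eq)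
  have "r / \<rho> \<le> ?C * (r / \<rho>)" using C K_ge_1 r \<rho> mult_right_mono[of 1 ?C "r / \<rho>"] by simp
  then have r_le_scale: "r / \<rho> \<le> 1" using radius_small by linarith
  have rescaled: "\<bar>(t - x) / \<rho>\<bar> \<le> r / \<rho>" "?C * \<bar>(t - x) / \<rho>\<bar> \<le> 1" if "\<bar>t - x\<bar> \<le> r" for t
  proof -
    show *: "\<bar>(t - x) / \<rho>\<bar> \<le> r / \<rho>" using that \<rho> by (simp add: divide_right_mono)
    show "?C * \<bar>(t - x) / \<rho>\<bar> \<le> 1" using mult_left_mono[OF *, of ?C] radius_small C K_ge_1 by linarith
  qed
  show thesis
  proof (rule that[of p, folded \<rho>_def])
    fix t :: real assume t: "t \<in> {0..1}" "\<bar>t - x\<bar> \<le> r"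
    define s where "s = (t - x) / \<rho>"
    have "\<bar>s\<bar> ^ S \<le> (r / \<rho>) ^ S" using rescaled[OF t(2)] by (intro power_mono) (auto simp: s_def)
    also have "\<dots> \<le> (r / \<rho>) powr \<beta>"
      using r \<rho> r_le_scale exponent_less by (subst powr_realpow[symmetric]) (auto intro!: powr_mono')
    also have "\<dots> = r powr \<beta> / f x" using r \<rho> by (simp add: powr_divide)
    finally have "?C * \<bar>s\<bar> ^ S \<le> ?C * (r powr \<beta> / f x)"
      using C K_ge_1 by (intro mult_left_mono) auto
    moreover have "K * \<bar>t - x\<bar> powr \<beta> / f x \<le> ?C * (r powr \<beta> / f x)"
      using t C K_ge_1 exponent_pos fx by (auto intro!: divide_right_mono mult_mono powr_mono2)
    ultimately show "\<bar>f t / f x - (\<Sum>i<S. p i * ((t - x) / \<rho>) ^ i)\<^sup>2\<bar> \<le> 2 * ?C * (r powr \<beta> / f x)"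
      using f_approx[OF t(1)] p_square[OF rescaled(2)[OF t(2)]] unfolding s_def by linarith
  qed (use p rescaled in blast)
qed

lemma sqrt_local_polynomial:
  assumes "x \<in> {0..1}" and fx: "0 < f x" and "0 < r"
    and "sqrt_approx_const S K * r \<le> f x powr (1 / \<beta>)"
  obtains p where "\<And>t. t \<in> {0..1} \<Longrightarrow> \<bar>t - x\<bar> \<le> r \<Longrightarrow>
    \<bar>sqrt (f t) - (\<Sum>i<S. p i * (t - x) ^ i)\<bar> \<le> 4 * sqrt_approx_const S K * r powr \<beta> / sqrt (f x)"
proof -
  let ?C = "sqrt_approx_const S K"
  define \<rho> where "\<rho> = f x powr (1 / \<beta>)"
  obtain p where p: "\<And>t. \<bar>t - x\<bar> \<le> r \<Longrightarrow> 1 / 2 \<le> (\<Sum>i<S. p i * ((t - x) / \<rho>) ^ i)"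
    and p_square: "\<And>t. t \<in> {0..1} \<Longrightarrow> \<bar>t - x\<bar> \<le> r \<Longrightarrow>
      \<bar>f t / f x - (\<Sum>i<S. p i * ((t - x) / \<rho>) ^ i)\<^sup>2\<bar> \<le> 2 * ?C * (r powr \<beta> / f x)"
    using normalised_square_approx[OF assms] unfolding \<rho>_def by blast
  show thesis
  proof (rule that[of "\<lambda>i. sqrt (f x) * p i / \<rho> ^ i"])
    fix t :: real assume t: "t \<in> {0..1}" and tr: "\<bar>t - x\<bar> \<le> r"
    define P where "P = (\<Sum>i<S. p i * ((t - x) / \<rho>) ^ i)"
    have root: "\<bar>sqrt (f t / f x) - P\<bar> \<le> 4 * ?C * (r powr \<beta> / f x)"
      using abs_sqrt_diff_le[of "f t / f x" "1 / 2" P] p[OF tr] p_square[OF t tr] nonneg[OF t] fx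
      unfolding P_def by simp
    have "(\<Sum>i<S. sqrt (f x) * p i / \<rho> ^ i * (t - x) ^ i) = sqrt (f x) * P"
      unfolding P_def sum_distrib_left by (simp add: power_divide mult.assoc)
    then have "\<bar>sqrt (f t) - (\<Sum>i<S. sqrt (f x) * p i / \<rho> ^ i * (t - x) ^ i)\<bar>
        = sqrt (f x) * \<bar>sqrt (f t / f x) - P\<bar>"
      using fx by (simp add: abs_mult_pos' right_diff_distrib real_sqrt_divide)
    also have "\<dots> \<le> sqrt (f x) * (4 * ?C * (r powr \<beta> / f x))" using root fx by (intro mult_left_mono) auto
    also have "\<dots> = 4 * ?C * r powr \<beta> * (sqrt (f x) / f x)" by simp
    also have "sqrt (f x) / f x = 1 / sqrt (f x)" using fx by (simp add: sqrt_divide_self_eq inverse_eq_divide)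
    finally show "\<bar>sqrt (f t) - (\<Sum>i<S. sqrt (f x) * p i / \<rho> ^ i * (t - x) ^ i)\<bar>
        \<le> 4 * ?C * r powr \<beta> / sqrt (f x)" by simp
  qed
qed

end

subsection \<open>Coefficients of the square root against localised functions\<close>

abbreviation inner_L2 :: "(real \<Rightarrow> real) \<Rightarrow> (real \<Rightarrow> real) \<Rightarrow> real" where
  "inner_L2 w g \<equiv> LINT t:{0..1}|lborel. w t * g t"

lemma set_integrable_mult_continuous:
  fixes w g :: "real \<Rightarrow> real"
  assumes "continuous_on {0..1} w" "continuous_on {0..1} g"
  shows "set_integrable lborel {0..1} (\<lambda>t. w t * g t)"
  using assms by (intro borel_integrable_atLeastAtMost' continuous_on_mult)

lemma inner_L2_diff_right:
  assumes "continuous_on {0..1} w" "continuous_on {0..1} g" "continuous_on {0..1} h"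
  shows "inner_L2 w (\<lambda>t. g t - h t) = inner_L2 w g - inner_L2 w h"
  unfolding right_diff_distrib using assms by (intro set_integral_diff set_integrable_mult_continuous)

lemma inner_L2_sum_right:
  assumes "continuous_on {0..1} w" "\<And>i. i \<in> A \<Longrightarrow> continuous_on {0..1} (h i)"
  shows "inner_L2 w (\<lambda>t. \<Sum>i\<in>A. a i * h i t) = (\<Sum>i\<in>A. a i * inner_L2 w (h i))"
proof -
  have "inner_L2 w (\<lambda>t. \<Sum>i\<in>A. a i * h i t) = (LINT t:{0..1}|lborel. \<Sum>i\<in>A. a i * (w t * h i t))"
    by (simp add: sum_distrib_left mult_ac)
  also have "\<dots> = (\<Sum>i\<in>A. LINT t:{0..1}|lborel. a i * (w t * h i t))"
    unfolding set_lebesgue_integral_def scaleR_sum_right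
    using assms set_integrable_mult_continuous[unfolded set_integrable_def]
    by (intro Bochner_Integration.integral_sum) (simp add: mult.left_commute)
  finally show ?thesis by simp
qed

lemma vanishing_moments_orthogonal_poly:
  fixes q :: "real poly"
  assumes w: "continuous_on {0..1} w" and moments: "\<And>m. m < S \<Longrightarrow> inner_L2 w (\<lambda>t. t ^ m) = 0"
    and "degree q < S"
  shows "inner_L2 w (poly q) = 0"
proof -
  have "inner_L2 w (poly q) = (\<Sum>i\<le>degree q. coeff q i * inner_L2 w (\<lambda>t. t ^ i))"
    unfolding poly_altdef by (intro inner_L2_sum_right w continuous_intros)
  also have "\<dots> = 0" using moments assms(3) by simp
  finally show ?thesis .
qed

definition atom_at :: "real \<Rightarrow> real \<Rightarrow> real \<Rightarrow> (real \<Rightarrow> real) \<Rightarrow> bool" where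
  "atom_at c s x w \<longleftrightarrow> continuous_on {0..1} w \<and> (\<forall>t\<in>{0..1}. \<bar>w t\<bar> \<le> c / sqrt s) \<and>
    (\<forall>t\<in>{0..1}. w t \<noteq> 0 \<longrightarrow> \<bar>t - x\<bar> \<le> c * s)"

lemma atom_inner_L2_le:
  assumes w: "atom_at c s x w" and c: "0 \<le> c" and s: "0 < s" and g: "continuous_on {0..1} g"
    and B: "0 \<le> B" "\<And>t. t \<in> {0..1} \<Longrightarrow> \<bar>t - x\<bar> \<le> c * s \<Longrightarrow> \<bar>g t\<bar> \<le> B"
  shows "\<bar>inner_L2 w g\<bar> \<le> 2 * c\<^sup>2 * sqrt s * B"
proof -
  let ?I = "{x - c * s..x + c * s}" and ?D = "c / sqrt s * B"
  have "norm (LINT t|lborel. indicator {0..1} t *\<^sub>R (w t * g t)) \<le> (LINT t|lborel. indicator ?I t * ?D)"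
  proof (rule order_trans[OF integral_norm_bound integral_mono])
    show "integrable lborel (\<lambda>t. norm (indicator {0..1} t *\<^sub>R (w t * g t)))"
      using set_integrable_mult_continuous[of w g] w g
      by (intro integrable_norm) (simp add: set_integrable_def atom_at_def)
    show "integrable lborel (\<lambda>t. indicat_real ?I t * ?D)"
      by (intro integrable_mult_left integrable_real_indicator) (auto simp: emeasure_lborel_Icc_eq)
    fix t :: real
    show "norm (indicator {0..1} t *\<^sub>R (w t * g t)) \<le> indicator ?I t * ?D"
    proof (cases "t \<in> {0..1} \<and> w t \<noteq> 0")
      case True
      then have "\<bar>w t\<bar> \<le> c / sqrt s" and near: "\<bar>t - x\<bar> \<le> c * s" using w by (auto simp: atom_at_def)
      then have "\<bar>w t * g t\<bar> \<le> ?D"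
        unfolding abs_mult using True B c s by (intro mult_mono) auto
      moreover have "t \<in> ?I" using near by auto
      ultimately show ?thesis using True by simp
    qed (use B c s in auto)
  qed
  also have "\<dots> = 2 * c\<^sup>2 * (s / sqrt s) * B" using c s by (simp add: power2_eq_square)
  also have "s / sqrt s = sqrt s" using s by (simp add: real_div_sqrt)
  finally show ?thesis by (simp add: set_lebesgue_integral_def)
qed

definition decay_const :: "nat \<Rightarrow> real \<Rightarrow> real \<Rightarrow> real" where
  "decay_const S K c = 8 * (real S + 1) * c\<^sup>2 * sqrt_approx_const S K * (c * sqrt_approx_const S K) ^ S"

context flat_Hoelder
begin

lemma approx_const_ge: "4 * K \<le> sqrt_approx_const S K" "1 \<le> sqrt_approx_const S K"
  using sqrt_approx_const_ge[OF K_ge_1 degree_pos] K_ge_1 by auto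

lemma decay_const_nonneg: "0 \<le> c \<Longrightarrow> 0 \<le> decay_const S K c"
  using approx_const_ge by (simp add: decay_const_def)

lemma powr_dilation_le:
  assumes "1 \<le> a" "0 < s" "p \<le> \<beta>"
  shows "(a * s) powr p \<le> a ^ S * s powr p"
proof -
  have "a powr p \<le> a powr real S" using assms exponent_less by (intro powr_mono) auto
  then have "a powr p \<le> a ^ S" using assms by (simp add: powr_realpow)
  then show ?thesis using assms by (simp add: powr_mult mult_right_mono)
qed

lemma length_scale_powr:
  assumes "x \<in> {0..1}"
  shows "(f x powr (1 / \<beta>)) powr \<beta> = f x" "(f x powr (1 / \<beta>)) powr (\<beta> / 2) = sqrt (f x)"
  using nonneg[OF assms] exponent_pos by (simp_all add: powr_powr powr_half_sqrt)

text \<open>Below the length scale of \<open>f\<close> at \<open>x\<close> the moments annihilate the local polynomial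
  approximation of \<open>sqrt f\<close>; above it \<open>f\<close> itself is of order \<open>s powr \<beta>\<close> on the support of \<open>w\<close>.\<close>

lemma fine_scale_coefficient:
  assumes w: "atom_at c s x w" and c: "1 \<le> c" and s: "0 < s" and x: "x \<in> {0..1}"
    and moments: "s < 1 \<Longrightarrow> \<forall>m<S. inner_L2 w (\<lambda>t. t ^ m) = 0"
    and fine: "sqrt_approx_const S K * (c * s) \<le> f x powr (1 / \<beta>)"
  shows "sqrt (f x) * \<bar>inner_L2 w (\<lambda>t. sqrt (f t))\<bar> \<le> decay_const S K c * (sqrt s * s powr \<beta>)"
proof -
  let ?C = "sqrt_approx_const S K" and ?\<theta> = "inner_L2 w (\<lambda>t. sqrt (f t))"
  note C = approx_const_ge
  have cs: "0 < c * s" using c s by simp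
  then have "0 < ?C * (c * s)" using C by simp
  then have "f x powr (1 / \<beta>) \<noteq> 0" using fine by linarith
  then have fx: "0 < f x" using nonneg[OF x] by (simp add: less_le)
  have "4 * K * (1 * s) \<le> ?C * (c * s)" using C c s by (intro mult_mono) auto
  then have "4 * K * s \<le> K * 1" using fine length_scale_le[OF x] by linarith
  then have "s < 1" using K_ge_1 s by (simp add: mult.assoc mult.left_commute[of 4])
  obtain p where p: "\<And>t. t \<in> {0..1} \<Longrightarrow> \<bar>t - x\<bar> \<le> c * s \<Longrightarrow>
      \<bar>sqrt (f t) - (\<Sum>i<S. p i * (t - x) ^ i)\<bar> \<le> 4 * ?C * (c * s) powr \<beta> / sqrt (f x)"
    using sqrt_local_polynomial[OF x fx cs fine] by blast
  define q where "q = (\<Sum>i<S. smult (p i) ([:- x, 1:] ^ i))"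
  have q: "poly q t = (\<Sum>i<S. p i * (t - x) ^ i)" for t by (simp add: q_def poly_sum)
  have "degree q < S" unfolding q_def
    by (intro degree_sum_less degree_pos)
      (auto intro: le_less_trans[OF degree_smult_le] simp: degree_linear_power)
  have cont: "continuous_on {0..1} w" "continuous_on {0..1} (poly q)"
    using w by (auto simp: atom_at_def intro: continuous_intros)
  have "?\<theta> = inner_L2 w (\<lambda>t. sqrt (f t) - poly q t)"
    using vanishing_moments_orthogonal_poly[OF cont(1) _ \<open>degree q < S\<close>] moments[OF \<open>s < 1\<close>]
    by (simp add: inner_L2_diff_right cont continuous_sqrt)
  also have "\<bar>\<dots>\<bar> \<le> 2 * c\<^sup>2 * sqrt s * (4 * ?C * (c * s) powr \<beta> / sqrt (f x))"
    using p c s C fx by (intro atom_inner_L2_le[OF w] continuous_on_diff continuous_sqrt cont) (auto simp: q)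
  finally have "sqrt (f x) * \<bar>?\<theta>\<bar> \<le> 8 * c\<^sup>2 * ?C * sqrt s * (c * s) powr \<beta>"
    using fx by (simp add: pos_le_divide_eq mult_ac)
  also have "(c * s) powr \<beta> \<le> c ^ S * s powr \<beta>" by (rule powr_dilation_le[OF c s order_refl])
  finally have "sqrt (f x) * \<bar>?\<theta>\<bar> \<le> (8 * c\<^sup>2 * ?C * c ^ S) * (sqrt s * s powr \<beta>)"
    using c s C by (simp add: mult_ac mult_left_mono)
  also have "\<dots> \<le> decay_const S K c * (sqrt s * s powr \<beta>)"
  proof (intro mult_right_mono)
    have "c ^ S \<le> (c * ?C) ^ S" using c C by (intro power_mono) auto
    then have "8 * c\<^sup>2 * ?C * (1 * c ^ S) \<le> 8 * c\<^sup>2 * ?C * ((real S + 1) * (c * ?C) ^ S)"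
      using c C by (intro mult_left_mono mult_mono) auto
    then show "8 * c\<^sup>2 * ?C * c ^ S \<le> decay_const S K c" by (simp only: decay_const_def mult_ac mult_1)
  qed (use s in simp)
  finally show ?thesis .
qed

lemma coarse_scale_coefficient:
  assumes w: "atom_at c s x w" and c: "1 \<le> c" and s: "0 < s" and x: "x \<in> {0..1}"
    and coarse: "f x powr (1 / \<beta>) \<le> sqrt_approx_const S K * (c * s)"
  shows "\<bar>inner_L2 w (\<lambda>t. sqrt (f t))\<bar> \<le> decay_const S K c * (sqrt s * s powr (\<beta> / 2))"
    and "sqrt (f x) * \<bar>inner_L2 w (\<lambda>t. sqrt (f t))\<bar> \<le> decay_const S K c * (sqrt s * s powr \<beta>)"
proof -
  let ?C = "sqrt_approx_const S K" and ?\<theta> = "inner_L2 w (\<lambda>t. sqrt (f t))"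
  let ?D = "2 * c\<^sup>2 * ((real S + 1) * K)"
  note C = approx_const_ge
  define r where "r = (c * ?C) * s"
  have cC_ge_1: "1 \<le> c * ?C" using c C mult_mono[of 1 c 1 ?C] by simp
  have r: "0 < r" "c * s \<le> r" using cC_ge_1 c s C mult_right_mono[of c "c * ?C" s] by (auto simp: r_def)
  have scale_le_r: "f x powr (1 / \<beta>) \<le> r" using coarse by (simp add: r_def mult_ac)
  have fx: "f x \<le> r powr \<beta>" "sqrt (f x) \<le> r powr (\<beta> / 2)"
    using powr_mono2[OF _ _ scale_le_r, of \<beta>] powr_mono2[OF _ _ scale_le_r, of "\<beta> / 2"] exponent_pos
    by (simp_all add: length_scale_powr[OF x])
  have "\<bar>sqrt (f t)\<bar> \<le> (real S + 1) * K * r powr (\<beta> / 2)" if "t \<in> {0..1}" "\<bar>t - x\<bar> \<le> c * s" for t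
    using sqrt_local_upper_bound[OF x that(1) r(1) _ fx(1)] nonneg[OF that(1)] that(2) r(2) by simp
  then have "\<bar>?\<theta>\<bar> \<le> 2 * c\<^sup>2 * sqrt s * ((real S + 1) * K * r powr (\<beta> / 2))"
    using c s K_ge_1 by (intro atom_inner_L2_le[OF w] continuous_sqrt) auto
  then have \<theta>: "\<bar>?\<theta>\<bar> \<le> ?D * sqrt s * r powr (\<beta> / 2)" by (simp add: mult_ac)
  have decay: "?D * sqrt s * r powr p \<le> decay_const S K c * (sqrt s * s powr p)" if "p \<le> \<beta>" for p
  proof -
    have dilation: "r powr p \<le> (c * ?C) ^ S * s powr p"
      unfolding r_def by (rule powr_dilation_le[OF cC_ge_1 s that])
    have D: "?D \<le> 8 * (real S + 1) * c\<^sup>2 * ?C"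
      using C K_ge_1 mult_left_mono[of "2 * K" "8 * ?C" "(real S + 1) * c\<^sup>2"] by (simp only: mult_ac) simp
    have "(?D * sqrt s) * r powr p \<le> (8 * (real S + 1) * c\<^sup>2 * ?C * sqrt s) * ((c * ?C) ^ S * s powr p)"
      by (rule mult_mono[OF mult_right_mono[OF D] dilation]) (use C s in auto)
    then show ?thesis by (simp add: decay_const_def mult_ac)
  qed
  show "\<bar>?\<theta>\<bar> \<le> decay_const S K c * (sqrt s * s powr (\<beta> / 2))"
    using order_trans[OF \<theta> decay] exponent_pos by simp
  have "sqrt (f x) * \<bar>?\<theta>\<bar> \<le> r powr (\<beta> / 2) * (?D * sqrt s * r powr (\<beta> / 2))"
    using fx(2) \<theta> by (intro mult_mono) auto
  also have "\<dots> = ?D * sqrt s * r powr \<beta>"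
    by (simp add: powr_add[symmetric] mult.assoc mult.left_commute[of "r powr (\<beta> / 2)"])
  finally show "sqrt (f x) * \<bar>?\<theta>\<bar> \<le> decay_const S K c * (sqrt s * s powr \<beta>)"
    using decay[of \<beta>] by simp
qed

lemma coefficient_decay:
  assumes w: "atom_at c s x w" and c: "1 \<le> c" and s: "0 < s" and x: "x \<in> {0..1}"
    and moments: "s < 1 \<Longrightarrow> \<forall>m<S. inner_L2 w (\<lambda>t. t ^ m) = 0"
  shows "\<bar>inner_L2 w (\<lambda>t. sqrt (f t))\<bar> \<le> decay_const S K c * (sqrt s * s powr (\<beta> / 2))"
    and "sqrt (f x) * \<bar>inner_L2 w (\<lambda>t. sqrt (f t))\<bar> \<le> decay_const S K c * (sqrt s * s powr \<beta>)"
proof -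
  let ?C = "sqrt_approx_const S K" and ?\<theta> = "inner_L2 w (\<lambda>t. sqrt (f t))" and ?A = "decay_const S K c"
  let ?\<rho> = "f x powr (1 / \<beta>)"
  have "\<bar>?\<theta>\<bar> \<le> ?A * (sqrt s * s powr (\<beta> / 2)) \<and> sqrt (f x) * \<bar>?\<theta>\<bar> \<le> ?A * (sqrt s * s powr \<beta>)"
  proof (cases "?C * (c * s) \<le> ?\<rho>")
    case False
    then show ?thesis using coarse_scale_coefficient[OF w c s x] by simp
  next
    case True
    note bound = fine_scale_coefficient[OF w c s x moments True]
    have "1 \<le> ?C * c" using c approx_const_ge mult_mono[of 1 ?C 1 c] by simp
    then have "s \<le> ?\<rho>" using True s mult_right_mono[of 1 "?C * c" s] unfolding mult.assoc by linarith
    then have s_root: "s powr (\<beta> / 2) \<le> sqrt (f x)"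
      using powr_mono2[of "\<beta> / 2" s ?\<rho>] s exponent_pos by (simp add: length_scale_powr[OF x])
    then have root_pos: "0 < sqrt (f x)" using s by (intro less_le_trans[OF _ s_root]) simp
    have "s powr \<beta> = s powr (\<beta> / 2) * s powr (\<beta> / 2)" by (simp add: powr_add[symmetric])
    then have "?A * (sqrt s * s powr \<beta>) \<le> sqrt (f x) * (?A * (sqrt s * s powr (\<beta> / 2)))"
      using s_root decay_const_nonneg[of c] c s
        mult_right_mono[OF s_root, of "?A * (sqrt s * s powr (\<beta> / 2))"] by (simp add: mult_ac)
    then have "sqrt (f x) * \<bar>?\<theta>\<bar> \<le> sqrt (f x) * (?A * (sqrt s * s powr (\<beta> / 2)))"
      using bound by linarith
    then show ?thesis using bound root_pos by (simp only: mult_le_cancel_left_pos)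
  qed
  then show "\<bar>?\<theta>\<bar> \<le> ?A * (sqrt s * s powr (\<beta> / 2))" "sqrt (f x) * \<bar>?\<theta>\<bar> \<le> ?A * (sqrt s * s powr \<beta>)"
    by blast+
qed

end

subsection \<open>Wavelet expansions\<close>

lemma inner_L2_sums:
  assumes w: "continuous_on {0..1} w" and p: "\<And>i. continuous_on {0..1} (p i)"
    and b: "summable b" "\<And>i t. t \<in> {0..1} \<Longrightarrow> \<bar>p i t\<bar> \<le> b i"
  shows "(\<lambda>i. inner_L2 w (p i)) sums inner_L2 w (\<lambda>t. \<Sum>i. p i t)"
proof -
  let ?h = "\<lambda>i t. indicator {0..1} t *\<^sub>R (w t * p i t)"
  obtain B where B: "\<forall>t\<in>{0..1}. \<bar>w t\<bar> \<le> B"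
    using compact_imp_bounded[OF compact_continuous_image[OF w]] by (auto simp: bounded_iff)
  have bound: "norm (?h i t) \<le> indicator {0..1} t * (B * b i)" for i t
    using B b(2)[of t i] by (auto simp: indicator_def abs_mult intro!: mult_mono')
  have int: "integrable lborel (?h i)" for i
    using set_integrable_mult_continuous[OF w p] by (simp add: set_integrable_def)
  have summable_b: "summable (\<lambda>i. B * b i)" using b(1) by (rule summable_mult)
  have "(\<lambda>i. integral\<^sup>L lborel (?h i)) sums (LINT t|lborel. (\<Sum>i. ?h i t))"
  proof (rule sums_integral[OF int])
    have "summable (\<lambda>i. norm (?h i t))" for t
      by (rule summable_comparison_test[OF _ summable_mult[OF summable_b]]) (use bound in auto)
    then show "AE t in lborel. summable (\<lambda>i. norm (?h i t))" by simp
    have "(LINT t|lborel. norm (?h i t)) \<le> (LINT t|lborel. indicator {0..1::real} t * (B * b i))" for i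
      by (intro integral_mono bound integrable_norm[OF int] integrable_mult_left integrable_real_indicator)
        (auto simp: emeasure_lborel_Icc_eq)
    then show "summable (\<lambda>i. LINT t|lborel. norm (?h i t))"
      by (intro summable_comparison_test[OF _ summable_b]) auto
  qed
  moreover have "(\<Sum>i. ?h i t) = indicator {0..1} t *\<^sub>R (w t * (\<Sum>i. p i t))" for t
  proof (cases "t \<in> {0..1}")
    case True
    then have "summable (\<lambda>i. p i t)" using b by (intro summable_comparison_test[OF _ b(1)]) auto
    then show ?thesis using True by (simp add: suminf_mult)
  qed simp
  ultimately show ?thesis by (simp add: set_lebesgue_integral_def)
qed

lemma AE_zero_imp_continuous_zero:
  fixes h :: "real \<Rightarrow> real"
  assumes h: "continuous_on {0..1} h" and "AE t in lborel. t \<in> {0..1} \<longrightarrow> h t = 0" and x: "x \<in> {0..1}"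
  shows "h x = 0"
proof -
  have "(LINT t:{0..1}|lborel. \<bar>h t\<bar>) = 0"
    unfolding set_lebesgue_integral_def
    by (rule integral_eq_zero_AE, use assms(2) in eventually_elim) (auto simp: indicator_def)
  then have "integral {0..1} (\<lambda>t. \<bar>h t\<bar>) = 0"
    using h by (subst set_borel_integral_eq_integral(2)[symmetric])
      (auto intro: borel_integrable_atLeastAtMost' continuous_on_rabs)
  then have "((\<lambda>t. \<bar>h t\<bar>) has_integral 0) (cbox 0 1)"
    using integrable_continuous_interval[OF continuous_on_rabs[OF h]] by (metis box_real(2) integrable_integral)
  from has_integral_0_cbox_imp_0[OF _ _ this, of x] show ?thesis
    using h x by (simp add: continuous_on_rabs)
qed

text \<open>Levels are counted from 0, so that level \<open>i\<close> is the level \<open>j = i - 1\<close> of the paper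
  and level 0 consists of the scaling functions.\<close>

locale wavelet_system =
  fixes S :: nat and \<psi> :: "nat \<Rightarrow> 'k \<Rightarrow> real \<Rightarrow> real" and I :: "nat \<Rightarrow> 'k set" and c :: real
  assumes c_ge_1: "1 \<le> c"
    and finite_index: "finite (I i)" and card_index: "real (card (I i)) \<le> c * 2 ^ i"
    and measurable_psi: "k \<in> I i \<Longrightarrow> \<psi> i k \<in> borel_measurable borel"
    and continuous_psi: "k \<in> I i \<Longrightarrow> continuous_on {0..1} (\<psi> i k)"
    and psi_le: "k \<in> I i \<Longrightarrow> x \<in> {0..1} \<Longrightarrow> \<bar>\<psi> i k x\<bar> \<le> c * sqrt (2 ^ i)"
    and psi_support: "k \<in> I i \<Longrightarrow> x \<in> {0..1} \<Longrightarrow> \<psi> i k x \<noteq> 0 \<Longrightarrow> t \<in> {0..1} \<Longrightarrow> \<psi> i k t \<noteq> 0 \<Longrightarrow>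
      \<bar>t - x\<bar> \<le> c / 2 ^ i"
    and overlap: "x \<in> {0..1} \<Longrightarrow> real (card {k \<in> I i. \<psi> i k x \<noteq> 0}) \<le> c"
    and orthonormal: "k \<in> I i \<Longrightarrow> k' \<in> I i' \<Longrightarrow>
      inner_L2 (\<psi> i k) (\<psi> i' k') = (if i = i' \<and> k = k' then 1 else 0)"
    and complete: "g \<in> borel_measurable borel \<Longrightarrow> set_integrable lborel {0..1} (\<lambda>t. (g t)\<^sup>2) \<Longrightarrow>
      (\<And>i k. k \<in> I i \<Longrightarrow> inner_L2 (\<psi> i k) g = 0) \<Longrightarrow> AE t in lborel. t \<in> {0..1} \<longrightarrow> g t = 0"
    and moments: "0 < i \<Longrightarrow> k \<in> I i \<Longrightarrow> m < S \<Longrightarrow> inner_L2 (\<psi> i k) (\<lambda>t. t ^ m) = 0"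

lemma level_powr:
  "2 powr real_of_int (int i - 1) = 2 ^ i / 2" "2 powr - real_of_int (int i - 1) = 2 / 2 ^ i"
  "2 powr (real_of_int (int i - 1) / 2) \<le> sqrt (2 ^ i)"
  using powr_mono[of "real_of_int (int i - 1) / 2" "real i / 2" 2]
  by (simp_all add: powr_diff powr_realpow[symmetric] powr_half_sqrt[symmetric] powr_powr)

lemma wavelet_at_level:
  assumes amplitude: "\<forall>x\<in>{0..1}. \<bar>w x\<bar> \<le> c * 2 powr (real_of_int (int i - 1) / 2)"
    and support: "\<exists>a. \<forall>x\<in>{0..1}. w x \<noteq> 0 \<longrightarrow> \<bar>x - a\<bar> \<le> c * 2 powr - real_of_int (int i - 1)"
    and c: "0 < c" "4 * c \<le> C" and x: "x \<in> {0..1}"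
  shows "\<bar>w x\<bar> \<le> C * sqrt (2 ^ i)"
    and "w x \<noteq> 0 \<Longrightarrow> t \<in> {0..1} \<Longrightarrow> w t \<noteq> 0 \<Longrightarrow> \<bar>t - x\<bar> \<le> C / 2 ^ i"
proof -
  have "\<bar>w x\<bar> \<le> c * 2 powr (real_of_int (int i - 1) / 2)" using amplitude x by blast
  also have "\<dots> \<le> C * sqrt (2 ^ i)" using c level_powr(3) by (intro mult_mono) auto
  finally show "\<bar>w x\<bar> \<le> C * sqrt (2 ^ i)" .
  assume t: "w x \<noteq> 0" "t \<in> {0..1}" "w t \<noteq> 0"
  obtain a where "\<forall>x\<in>{0..1}. w x \<noteq> 0 \<longrightarrow> \<bar>x - a\<bar> \<le> c * (2 / 2 ^ i)"
    using support unfolding level_powr by blast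
  then have "\<bar>x - a\<bar> \<le> c * (2 / 2 ^ i)" "\<bar>t - a\<bar> \<le> c * (2 / 2 ^ i)" using x t by auto
  then have "\<bar>t - x\<bar> \<le> 4 * c / 2 ^ i" by simp
  also have "\<dots> \<le> C / 2 ^ i" using c by (intro divide_right_mono) auto
  finally show "\<bar>t - x\<bar> \<le> C / 2 ^ i" .
qed

lemma wavelet_basis_imp_system:
  assumes "wavelet_basis S \<psi> I"
  obtains c where "wavelet_system S (\<lambda>i. \<psi> (int i - 1)) (\<lambda>i. I (int i - 1)) c"
proof -
  obtain c where c: "0 < c"
    and index: "\<And>j. -1 \<le> j \<Longrightarrow> finite (I j) \<and> real (card (I j)) \<le> c * 2 powr (real_of_int j)"
    and psi: "\<And>j k. -1 \<le> j \<Longrightarrow> k \<in> I j \<Longrightarrow> \<psi> j k \<in> borel_measurable borel \<and> continuous_on {0..1} (\<psi> j k)"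
    and amplitude: "\<And>j k. -1 \<le> j \<Longrightarrow> k \<in> I j \<Longrightarrow> \<forall>x\<in>{0..1}. \<bar>\<psi> j k x\<bar> \<le> c * 2 powr (real_of_int j / 2)"
    and support: "\<And>j k. -1 \<le> j \<Longrightarrow> k \<in> I j \<Longrightarrow>
      \<exists>a. \<forall>x\<in>{0..1}. \<psi> j k x \<noteq> 0 \<longrightarrow> \<bar>x - a\<bar> \<le> c * 2 powr - real_of_int j"
    and overlap: "\<And>j x. -1 \<le> j \<Longrightarrow> x \<in> {0..1} \<Longrightarrow> real (card {k\<in>I j. \<psi> j k x \<noteq> 0}) \<le> c"
    and orth: "\<And>j k j' k'. -1 \<le> j \<Longrightarrow> k \<in> I j \<Longrightarrow> -1 \<le> j' \<Longrightarrow> k' \<in> I j' \<Longrightarrow>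
      inner_L2 (\<psi> j k) (\<psi> j' k') = (if j = j' \<and> k = k' then 1 else 0)"
    and complete: "\<And>g. g \<in> borel_measurable borel \<Longrightarrow> set_integrable lborel {0..1} (\<lambda>t. (g t)\<^sup>2) \<Longrightarrow>
      \<forall>j\<ge>-1. \<forall>k\<in>I j. inner_L2 (\<psi> j k) g = 0 \<Longrightarrow> AE t in lborel. t \<in> {0..1} \<longrightarrow> g t = 0"
    and moments: "\<And>j k m. 0 \<le> j \<Longrightarrow> k \<in> I j \<Longrightarrow> m < S \<Longrightarrow> inner_L2 (\<psi> j k) (\<lambda>t. t ^ m) = 0"
    using assms unfolding wavelet_basis_def by auto
  define C where "C = max 1 (4 * c)"
  have C: "1 \<le> C" "4 * c \<le> C" by (auto simp: C_def)
  have "wavelet_system S (\<lambda>i. \<psi> (int i - 1)) (\<lambda>i. I (int i - 1)) C"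
  proof
    fix i
    have "real (card (I (int i - 1))) \<le> c / 2 * 2 ^ i"
      using index[of "int i - 1", unfolded level_powr] by simp
    also have "\<dots> \<le> C * 2 ^ i" using C c by (intro mult_right_mono) auto
    finally show "real (card (I (int i - 1))) \<le> C * 2 ^ i" .
    fix x :: real assume x: "x \<in> {0..1}"
    show "real (card {k \<in> I (int i - 1). \<psi> (int i - 1) k x \<noteq> 0}) \<le> C"
      using overlap[OF _ x, of "int i - 1"] C c by simp
    fix k assume k: "k \<in> I (int i - 1)"
    note bounds = wavelet_at_level[OF amplitude[OF _ k] support[OF _ k] c C(2) x]
    show "\<bar>\<psi> (int i - 1) k x\<bar> \<le> C * sqrt (2 ^ i)" by (rule bounds(1)) simp_all
    show "\<bar>t - x\<bar> \<le> C / 2 ^ i"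
      if "\<psi> (int i - 1) k x \<noteq> 0" "t \<in> {0..1}" "\<psi> (int i - 1) k t \<noteq> 0" for t
      by (rule bounds(2)) (use that in simp_all)
  next
    fix g :: "real \<Rightarrow> real"
    assume g: "g \<in> borel_measurable borel" "set_integrable lborel {0..1} (\<lambda>t. (g t)\<^sup>2)"
      and ortho: "\<And>i k. k \<in> I (int i - 1) \<Longrightarrow> inner_L2 (\<psi> (int i - 1) k) g = 0"
    show "AE t in lborel. t \<in> {0..1} \<longrightarrow> g t = 0"
    proof (rule complete[OF g], intro allI impI ballI)
      fix j k assume "-1 \<le> j" "k \<in> I j"
      then show "inner_L2 (\<psi> j k) g = 0" using ortho[of k "nat (j + 1)"] by simp
    qed
  qed (use C(1) index psi orth moments in auto)
  then show thesis by (rule that)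
qed

context wavelet_system
begin

definition level :: "(nat \<Rightarrow> 'k \<Rightarrow> real) \<Rightarrow> nat \<Rightarrow> real \<Rightarrow> real" where
  "level a i x = (\<Sum>k\<in>I i. a i k * \<psi> i k x)"

abbreviation coeff_of :: "(real \<Rightarrow> real) \<Rightarrow> nat \<Rightarrow> 'k \<Rightarrow> real" where
  "coeff_of g i k \<equiv> inner_L2 (\<psi> i k) g"

lemma level_diff: "level (\<lambda>i k. a i k - b i k) i x = level a i x - level b i x"
  by (simp add: level_def left_diff_distrib sum_subtractf)

lemma level_scale: "level (\<lambda>i k. r * a i k) i x = r * level a i x"
  by (simp add: level_def sum_distrib_left mult.assoc)

lemma continuous_level: "continuous_on {0..1} (level a i)"
  unfolding level_def by (intro continuous_intros continuous_psi)

lemma coeff_of_level: "k \<in> I j \<Longrightarrow> coeff_of (level a i) j k = (if i = j then a j k else 0)"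
  unfolding level_def
  by (subst inner_L2_sum_right) (auto simp: continuous_psi orthonormal finite_index if_distrib cong: if_cong)

lemma level_le:
  assumes x: "x \<in> {0..1}" and B: "0 \<le> B" "\<And>k. k \<in> I i \<Longrightarrow> \<psi> i k x \<noteq> 0 \<Longrightarrow> sqrt (2 ^ i) * \<bar>a i k\<bar> \<le> B"
  shows "\<bar>level a i x\<bar> \<le> c\<^sup>2 * B"
proof -
  let ?N = "{k \<in> I i. \<psi> i k x \<noteq> 0}"
  have "level a i x = (\<Sum>k\<in>?N. a i k * \<psi> i k x)"
    unfolding level_def using finite_index by (intro sum.mono_neutral_right) auto
  also have "\<bar>\<dots>\<bar> \<le> (\<Sum>k\<in>?N. c * B)"
  proof (rule order_trans[OF sum_abs sum_mono])
    fix k assume k: "k \<in> ?N"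
    then have "\<bar>a i k * \<psi> i k x\<bar> \<le> \<bar>a i k\<bar> * (c * sqrt (2 ^ i))"
      unfolding abs_mult using psi_le x by (intro mult_left_mono) auto
    also have "\<dots> = c * (sqrt (2 ^ i) * \<bar>a i k\<bar>)" by simp
    also have "\<dots> \<le> c * B" using B(2) k c_ge_1 by (intro mult_left_mono) auto
    finally show "\<bar>a i k * \<psi> i k x\<bar> \<le> c * B" .
  qed
  also have "\<dots> \<le> c * (c * B)" using overlap[OF x, of i] B(1) c_ge_1 by (simp add: mult_right_mono)
  finally show ?thesis by (simp add: power2_eq_square mult_ac)
qed

lemma orthogonal_imp_zero:
  assumes h: "continuous_on {0..1} h" and orth: "\<And>i k. k \<in> I i \<Longrightarrow> coeff_of h i k = 0" and x: "x \<in> {0..1}"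
  shows "h x = 0"
proof -
  define H where "H t = indicator {0..1} t *\<^sub>R h t" for t
  have H_eq: "H t = h t" if "t \<in> {0..1}" for t using that by (simp add: H_def)
  have "H \<in> borel_measurable borel"
    unfolding H_def by (rule borel_measurable_continuous_on_indicator[OF _ h]) auto
  moreover have "set_integrable lborel {0..1} (\<lambda>t. (H t)\<^sup>2)"
    using set_integrable_mult_continuous[OF h h]
    by (rule set_integrable_cong[THEN iffD1, rotated -1]) (auto simp: H_eq power2_eq_square)
  moreover have "coeff_of H i k = 0" if "k \<in> I i" for i k
  proof -
    have "coeff_of H i k = coeff_of h i k"
      by (rule set_lebesgue_integral_cong) (auto simp: H_eq)
    then show ?thesis using orth[OF that] by simp
  qed
  ultimately have "AE t in lborel. t \<in> {0..1} \<longrightarrow> H t = 0" by (rule complete)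
  then have "AE t in lborel. t \<in> {0..1} \<longrightarrow> h t = 0" by eventually_elim (use H_eq in auto)
  then show ?thesis by (rule AE_zero_imp_continuous_zero[OF h _ x])
qed

lemma wavelet_expansion:
  assumes g: "continuous_on {0..1} g" and b: "summable b"
    and bound: "\<And>i x. x \<in> {0..1} \<Longrightarrow> \<bar>level (coeff_of g) i x\<bar> \<le> b i" and x: "x \<in> {0..1}"
  shows "(\<lambda>i. level (coeff_of g) i x) sums g x"
proof -
  define F where "F x = (\<Sum>i. level (coeff_of g) i x)" for x
  have sums: "(\<lambda>i. level (coeff_of g) i y) sums F y" if "y \<in> {0..1}" for y
    unfolding F_def by (rule summable_sums, rule summable_comparison_test[OF _ b]) (use bound that in auto)
  have "uniform_limit {0..1} (\<lambda>n x. \<Sum>i<n. level (coeff_of g) i x) F sequentially"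
    unfolding F_def by (rule Weierstrass_m_test[OF _ b]) (use bound in auto)
  then have F: "continuous_on {0..1} F"
    by (rule uniform_limit_theorem[rotated]) (auto intro!: always_eventually continuous_on_sum continuous_level)
  have "coeff_of (\<lambda>t. F t - g t) j k = 0" if k: "k \<in> I j" for j k
  proof -
    have "(\<lambda>i. coeff_of (level (coeff_of g) i) j k) sums coeff_of F j k"
      unfolding F_def by (rule inner_L2_sums[OF continuous_psi[OF k] continuous_level b bound])
    moreover have "(\<lambda>i. coeff_of (level (coeff_of g) i) j k) sums coeff_of g j k"
      using sums_single[of j "\<lambda>_. coeff_of g j k"] by (simp add: coeff_of_level[OF k])
    ultimately show ?thesis
      using sums_unique2 by (simp add: inner_L2_diff_right[OF continuous_psi[OF k] F g])
  qed
  from orthogonal_imp_zero[OF continuous_on_diff[OF F g] this x]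
  show ?thesis using sums[OF x] by simp
qed

end

subsection \<open>Balancing noise and decay over dyadic levels\<close>

lemma geometric_sum_le:
  fixes z :: real
  assumes "0 \<le> z" "z < 1"
  shows "(\<Sum>i<n. z ^ i) \<le> 1 / (1 - z)"
  using assms by (simp add: sum_gp_strict divide_right_mono)

definition balance_const :: "real \<Rightarrow> real" where
  "balance_const \<gamma> = 1 / (1 - 2 powr - (1 / 2)) + 1 / (1 - 2 powr - \<gamma>)"

lemma balance_const_antimono:
  assumes "0 < \<gamma>" "\<gamma> \<le> \<gamma>'"
  shows "balance_const \<gamma>' \<le> balance_const \<gamma>"
  using assms unfolding balance_const_def
  by (intro add_left_mono divide_left_mono mult_pos_pos) (auto simp: powr_less_one)

lemma balance_const_nonneg: "0 < \<gamma> \<Longrightarrow> 0 \<le> balance_const \<gamma>"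
  unfolding balance_const_def by (intro add_nonneg_nonneg) (auto simp: powr_less_one less_imp_le)

lemma sum_below_crossing:
  fixes a T :: real
  assumes a: "0 \<le> a" and T: "0 \<le> T" "\<And>i. i < N \<Longrightarrow> 2 ^ i \<le> T"
  shows "(\<Sum>i<N. sqrt (a * 2 ^ i)) \<le> sqrt (a * T) / (1 - 2 powr - (1 / 2))"
proof -
  have "(\<Sum>i<N. sqrt (a * 2 ^ i)) = (\<Sum>i<N. sqrt (a * 2 ^ (N - Suc i)))"
    by (rule sum.nat_diff_reindex[symmetric])
  also have "\<dots> \<le> (\<Sum>i<N. sqrt (a * T) * (2 powr - (1 / 2)) ^ i)"
  proof (rule sum_mono)
    fix i assume i: "i \<in> {..<N}"
    then have "2 ^ (N - Suc i) = 2 ^ (N - 1) / (2::real) ^ i" by (simp add: power_diff[symmetric])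
    also have "\<dots> \<le> T / 2 ^ i" using T(2)[of "N - 1"] i by (intro divide_right_mono) auto
    finally have "sqrt (a * 2 ^ (N - Suc i)) \<le> sqrt (a * (T / 2 ^ i))"
      using a by (intro mult_left_mono real_sqrt_le_mono) auto
    also have "\<dots> = sqrt (a * T) * (2 powr - (1 / 2)) ^ i"
      by (simp add: powr_minus_divide powr_half_sqrt
          real_sqrt_divide real_sqrt_mult real_sqrt_power power_divide)
    finally show "sqrt (a * 2 ^ (N - Suc i)) \<le> sqrt (a * T) * (2 powr - (1 / 2)) ^ i" .
  qed
  also have "\<dots> \<le> sqrt (a * T) * (1 / (1 - 2 powr - (1 / 2)))"
    unfolding sum_distrib_left[symmetric] using a T
    by (intro mult_left_mono geometric_sum_le) (auto simp: powr_less_one)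
  finally show ?thesis by simp
qed

lemma sum_above_crossing:
  fixes \<gamma> T :: real
  assumes \<gamma>: "0 < \<gamma>" and T: "0 < T" "T \<le> 2 ^ N"
  shows "(\<Sum>i<n. (2 ^ (N + i)) powr - \<gamma>) \<le> T powr - \<gamma> / (1 - 2 powr - \<gamma>)"
proof -
  have "(\<Sum>i<n. (2 ^ (N + i)) powr - \<gamma>) \<le> (\<Sum>i<n. T powr - \<gamma> * (2 powr - \<gamma>) ^ i)"
  proof (rule sum_mono)
    fix i
    have "(2 ^ (N + i)) powr - \<gamma> \<le> (T * 2 ^ i) powr - \<gamma>"
      using T \<gamma> by (intro powr_mono2') (auto simp: power_add)
    also have "\<dots> = T powr - \<gamma> * (2 powr - \<gamma>) ^ i"
      using T by (simp add: powr_mult powr_realpow[symmetric] powr_powr mult.commute)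
    finally show "(2 ^ (N + i)) powr - \<gamma> \<le> T powr - \<gamma> * (2 powr - \<gamma>) ^ i" .
  qed
  also have "\<dots> \<le> T powr - \<gamma> * (1 / (1 - 2 powr - \<gamma>))"
    unfolding sum_distrib_left[symmetric] using \<gamma>
    by (intro mult_left_mono geometric_sum_le) (auto simp: powr_less_one)
  finally show ?thesis by simp
qed

text \<open>The two bounds \<open>sqrt (a * 2 ^ i)\<close> and \<open>(2 ^ i) powr - \<gamma>\<close> cross where \<open>2 ^ i\<close> equals
  \<open>a powr (- 1 / (2 * \<gamma> + 1))\<close>; away from the crossing the smaller one decays geometrically.\<close>

lemma dyadic_balance:
  fixes a K \<gamma> :: real and e :: "nat \<Rightarrow> real"
  assumes \<gamma>: "0 < \<gamma>" and a: "0 < a" and K: "0 \<le> K"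
    and low: "\<And>i. i < m \<Longrightarrow> e i \<le> K * sqrt (a * 2 ^ i)"
    and high: "\<And>i. e i \<le> K * (2 ^ i) powr - \<gamma>"
    and crossing: "a powr (- 1 / (2 * \<gamma> + 1)) \<le> 2 ^ m"
  shows "(\<Sum>i<n. e i) \<le> K * balance_const \<gamma> * a powr (\<gamma> / (2 * \<gamma> + 1))"
proof -
  define T where "T = a powr (- 1 / (2 * \<gamma> + 1))"
  define M where "M = a powr (\<gamma> / (2 * \<gamma> + 1))"
  define N where "N = (LEAST N. T \<le> 2 ^ N)"
  have T: "0 < T" using a by (simp add: T_def)
  have "a * T = a powr (1 + - 1 / (2 * \<gamma> + 1))" unfolding T_def powr_add using a by simp
  also have "1 + - 1 / (2 * \<gamma> + 1) = \<gamma> / (2 * \<gamma> + 1) + \<gamma> / (2 * \<gamma> + 1)" using \<gamma> by (simp add: divide_simps)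
  finally have "a * T = M * M" by (simp only: M_def powr_add)
  then have M_low: "sqrt (a * T) = M" by (simp add: M_def)
  have M_high: "T powr - \<gamma> = M" by (simp add: T_def M_def powr_powr mult.commute)
  have T_le: "T \<le> 2 ^ N" unfolding N_def by (rule LeastI[of _ m]) (use crossing in \<open>simp add: T_def\<close>)
  have T_gt: "2 ^ i < T" if "i < N" for i
    using not_less_Least[of i "\<lambda>N. T \<le> 2 ^ N"] that by (simp add: N_def)
  have Nm: "N \<le> m" unfolding N_def by (rule Least_le) (use crossing in \<open>simp add: T_def\<close>)
  have low_sum: "(\<Sum>i<N. sqrt (a * 2 ^ i)) \<le> M / (1 - 2 powr - (1 / 2))"
    using sum_below_crossing[of a T N] a T T_gt by (simp add: M_low less_imp_le)
  have high_sum: "(\<Sum>i<n. (2 ^ (N + i)) powr - \<gamma>) \<le> M / (1 - 2 powr - \<gamma>)"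
    using sum_above_crossing[OF \<gamma> T T_le] by (simp add: M_high)
  define g where "g i = (if i < N then sqrt (a * 2 ^ i) else (2 ^ i) powr - \<gamma>)" for i
  have "(\<Sum>i<n. e i) \<le> (\<Sum>i<n. K * g i)" using low high Nm by (intro sum_mono) (auto simp: g_def)
  also have "\<dots> \<le> (\<Sum>i<N + n. K * g i)" using a K by (intro sum_mono2) (auto simp: g_def)
  also have "\<dots> = K * (\<Sum>i<N + n. g i)" by (simp add: sum_distrib_left)
  also have "(\<Sum>i<N + n. g i) = (\<Sum>i<N. g i) + (\<Sum>i<n. g (N + i))" by (induction n) auto
  also have "\<dots> = (\<Sum>i<N. sqrt (a * 2 ^ i)) + (\<Sum>i<n. (2 ^ (N + i)) powr - \<gamma>)" by (simp add: g_def)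
  also have "\<dots> \<le> balance_const \<gamma> * M"
    using low_sum high_sum by (simp add: balance_const_def distrib_right)
  finally show ?thesis using K by (simp add: M_def mult_left_mono mult.assoc)
qed

subsection \<open>The pathwise error bound\<close>

definition pointwise_rate :: "real \<Rightarrow> real \<Rightarrow> real \<Rightarrow> real" where
  "pointwise_rate v \<beta> u = max (v powr (\<beta> / (\<beta> + 1))) ((u * v) powr (\<beta> / (2 * \<beta> + 1)))"

lemma rtilde_eq_pointwise_rate: "rtilde n \<beta> u = pointwise_rate (ln (real n) / real n) \<beta> u"
  by (simp add: rtilde_def pointwise_rate_def)

definition root_error_const :: "real \<Rightarrow> real \<Rightarrow> real \<Rightarrow> real" where
  "root_error_const \<beta>1 c L = c\<^sup>2 * L * balance_const (\<beta>1 / 2)"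

lemma root_error_const_nonneg: "0 < \<beta>1 \<Longrightarrow> 0 \<le> L \<Longrightarrow> 0 \<le> root_error_const \<beta>1 c L"
  using balance_const_nonneg[of "\<beta>1 / 2"] by (simp add: root_error_const_def)

lemma root_error_const_ge:
  assumes "0 < \<beta>1" "\<beta>1 / 2 \<le> \<gamma>" "0 \<le> L"
  shows "c\<^sup>2 * L * balance_const \<gamma> \<le> root_error_const \<beta>1 c L"
  unfolding root_error_const_def using assms balance_const_antimono by (intro mult_left_mono) auto

definition rate_const :: "real \<Rightarrow> real \<Rightarrow> real \<Rightarrow> real" where
  "rate_const \<beta>1 c L = (root_error_const \<beta>1 c L)\<^sup>2 / 4 + root_error_const \<beta>1 c L"

locale flat_Hoelder_wavelets = wavelet_system S \<psi> I c + flat_Hoelder S \<beta> K f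
  for S :: nat and \<psi> :: "nat \<Rightarrow> 'k \<Rightarrow> real \<Rightarrow> real" and I c \<beta> K f
begin

lemma decay_nonneg: "0 \<le> decay_const S K c"
  using decay_const_nonneg[of c] c_ge_1 by simp

definition root_coeff :: "nat \<Rightarrow> 'k \<Rightarrow> real" where
  "root_coeff i k = 2 * coeff_of (\<lambda>t. sqrt (f t)) i k"

lemma atom_at_psi:
  assumes "k \<in> I i" "x \<in> {0..1}" "\<psi> i k x \<noteq> 0"
  shows "atom_at c (1 / 2 ^ i) x (\<psi> i k)"
  using assms continuous_psi psi_le psi_support by (auto simp: atom_at_def real_sqrt_divide)

lemma root_coeff_decay:
  assumes k: "k \<in> I i" and x: "x \<in> {0..1}" and nz: "\<psi> i k x \<noteq> 0"
  shows "sqrt (2 ^ i) * \<bar>root_coeff i k\<bar> \<le> 2 * decay_const S K c * (2 ^ i) powr - (\<beta> / 2)"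
    and "sqrt (2 ^ i) * (sqrt (f x) * \<bar>root_coeff i k\<bar>) \<le> 2 * decay_const S K c * (2 ^ i) powr - \<beta>"
proof -
  let ?s = "1 / 2 ^ i :: real"
  have moments: "\<forall>m<S. inner_L2 (\<psi> i k) (\<lambda>t. t ^ m) = 0" if "?s < 1"
    using that moments k by (cases i) auto
  note decay = coefficient_decay[OF atom_at_psi[OF k x nz] c_ge_1 _ x moments]
  have rescale: "sqrt (2 ^ i) * (2 * y) \<le> 2 * decay_const S K c * (2 ^ i) powr - p"
    if "y \<le> decay_const S K c * (sqrt ?s * ?s powr p)" for y p
  proof -
    have "sqrt (2 ^ i) * y \<le> sqrt (2 ^ i) * (decay_const S K c * (sqrt ?s * ?s powr p))"
      using that by (rule mult_left_mono) simp
    also have "\<dots> = decay_const S K c * (2 ^ i) powr - p"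
      by (simp add: real_sqrt_divide powr_divide powr_minus_divide)
    finally show ?thesis by simp
  qed
  show "sqrt (2 ^ i) * \<bar>root_coeff i k\<bar> \<le> 2 * decay_const S K c * (2 ^ i) powr - (\<beta> / 2)"
    using rescale[OF decay(1)] by (simp add: root_coeff_def abs_mult)
  show "sqrt (2 ^ i) * (sqrt (f x) * \<bar>root_coeff i k\<bar>) \<le> 2 * decay_const S K c * (2 ^ i) powr - \<beta>"
    using rescale[OF decay(2)] by (simp add: root_coeff_def abs_mult mult.left_commute)
qed

lemma level_root_coeff_sums:
  assumes x: "x \<in> {0..1}"
  shows "(\<lambda>i. level root_coeff i x) sums (2 * sqrt (f x))"
proof -
  let ?g = "\<lambda>t. sqrt (f t)" and ?z = "2 powr - (\<beta> / 2) :: real" and ?A = "2 * decay_const S K c"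
  have level_root_coeff: "level root_coeff i y = 2 * level (coeff_of ?g) i y" for i y
    unfolding root_coeff_def by (rule level_scale)
  have "\<bar>level root_coeff i y\<bar> \<le> c\<^sup>2 * (?A * (2 ^ i) powr - (\<beta> / 2))" if "y \<in> {0..1}" for i y
  proof (rule level_le[OF that])
    show "0 \<le> ?A * (2 ^ i) powr - (\<beta> / 2)" using decay_nonneg by simp
  qed (rule root_coeff_decay(1)[OF _ that])
  moreover have "(2 ^ i) powr - (\<beta> / 2) = ?z ^ i" for i
    by (simp add: powr_realpow[symmetric] powr_powr mult.commute)
  ultimately have "\<bar>level (coeff_of ?g) i y\<bar> \<le> c\<^sup>2 * ?A * ?z ^ i / 2" if "y \<in> {0..1}" for i y
    using that by (simp add: level_root_coeff abs_mult mult.assoc)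
  moreover have "summable (\<lambda>i. c\<^sup>2 * ?A * ?z ^ i / 2)"
    using exponent_pos by (intro summable_divide summable_mult summable_geometric) (auto simp: powr_less_one)
  ultimately have "(\<lambda>i. level (coeff_of ?g) i x) sums sqrt (f x)"
    using wavelet_expansion[OF continuous_sqrt _ _ x] by blast
  then show ?thesis unfolding level_root_coeff by (rule sums_mult)
qed

definition root_error :: "nat \<Rightarrow> (nat \<Rightarrow> 'k \<Rightarrow> real) \<Rightarrow> real \<Rightarrow> real" where
  "root_error m y x = \<bar>(\<Sum>i<m. level y i x) - 2 * sqrt (f x)\<bar>"

definition level_error :: "nat \<Rightarrow> (nat \<Rightarrow> 'k \<Rightarrow> real) \<Rightarrow> nat \<Rightarrow> real \<Rightarrow> real" where
  "level_error m y i x = \<bar>level (\<lambda>i k. (if i < m then y i k else 0) - root_coeff i k) i x\<bar>"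

lemma root_error_le:
  assumes x: "x \<in> {0..1}" and B: "\<And>n. (\<Sum>i<n. level_error m y i x) \<le> B"
  shows "root_error m y x \<le> B"
proof (rule LIMSEQ_le_const2)
  show "(\<lambda>n. \<bar>(\<Sum>i<m. level y i x) - (\<Sum>i<n. level root_coeff i x)\<bar>) \<longlonglongrightarrow> root_error m y x"
    using level_root_coeff_sums[OF x] unfolding sums_def root_error_def by (intro tendsto_intros)
  have "\<bar>(\<Sum>i<m. level y i x) - (\<Sum>i<n. level root_coeff i x)\<bar> \<le> B" if n: "m \<le> n" for n
  proof -
    have "(\<Sum>i<m. level y i x) = (\<Sum>i<n. level (\<lambda>i k. if i < m then y i k else 0) i x)"
      using n by (intro sum.mono_neutral_cong_left) (auto simp: level_def)
    then have "\<bar>(\<Sum>i<m. level y i x) - (\<Sum>i<n. level root_coeff i x)\<bar> \<le> (\<Sum>i<n. level_error m y i x)"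
      by (simp add: level_error_def level_diff sum_subtractf[symmetric] sum_abs)
    then show ?thesis using B by (rule order_trans)
  qed
  then show "\<exists>N. \<forall>n\<ge>N. \<bar>(\<Sum>i<m. level y i x) - (\<Sum>i<n. level root_coeff i x)\<bar> \<le> B" by blast
qed

definition accurate :: "real \<Rightarrow> real \<Rightarrow> nat \<Rightarrow> (nat \<Rightarrow> 'k \<Rightarrow> real) \<Rightarrow> real \<Rightarrow> bool" where
  "accurate L v m y x \<longleftrightarrow> (\<forall>i<m. \<forall>k\<in>I i. \<psi> i k x \<noteq> 0 \<longrightarrow>
    \<bar>y i k - root_coeff i k\<bar> \<le> L * sqrt v \<and>
    sqrt (2 ^ i) * \<bar>y i k - root_coeff i k\<bar> \<le> L * (2 ^ i) powr - (\<beta> / 2) \<and>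
    sqrt (2 ^ i) * (sqrt (f x) * \<bar>y i k - root_coeff i k\<bar>) \<le> L * (2 ^ i) powr - \<beta>)"

lemma level_error_bounds:
  assumes x: "x \<in> {0..1}" and acc: "accurate L v m y x" and L: "2 * decay_const S K c \<le> L" and v: "0 \<le> v"
  shows "i < m \<Longrightarrow> level_error m y i x \<le> c\<^sup>2 * L * sqrt (v * 2 ^ i)"
    and "level_error m y i x \<le> c\<^sup>2 * L * (2 ^ i) powr - (\<beta> / 2)"
    and "sqrt (f x) * level_error m y i x \<le> c\<^sup>2 * L * (2 ^ i) powr - \<beta>"
proof -
  let ?\<eta> = "\<lambda>i k. (if i < m then y i k else 0) - root_coeff i k"
  have L_nonneg: "0 \<le> L" using L decay_nonneg by linarith
  have decay: "sqrt (2 ^ i) * \<bar>?\<eta> i k\<bar> \<le> L * (2 ^ i) powr - (\<beta> / 2)"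
    "sqrt (2 ^ i) * (sqrt (f x) * \<bar>?\<eta> i k\<bar>) \<le> L * (2 ^ i) powr - \<beta>"
    if k: "k \<in> I i" "\<psi> i k x \<noteq> 0" for k
  proof -
    have "2 * decay_const S K c * (2 ^ i) powr p \<le> L * (2 ^ i) powr p" for p
      using L by (rule mult_right_mono) simp
    from order_trans[OF root_coeff_decay(1)[OF k(1) x k(2)] this]
      order_trans[OF root_coeff_decay(2)[OF k(1) x k(2)] this]
    show "sqrt (2 ^ i) * \<bar>?\<eta> i k\<bar> \<le> L * (2 ^ i) powr - (\<beta> / 2)"
      "sqrt (2 ^ i) * (sqrt (f x) * \<bar>?\<eta> i k\<bar>) \<le> L * (2 ^ i) powr - \<beta>"
      using acc k by (auto simp: accurate_def)
  qed
  show "level_error m y i x \<le> c\<^sup>2 * L * (2 ^ i) powr - (\<beta> / 2)"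
    unfolding level_error_def mult.assoc using decay(1) L_nonneg by (intro level_le[OF x]) auto
  have "sqrt (f x) * level_error m y i x = \<bar>level (\<lambda>i k. sqrt (f x) * ?\<eta> i k) i x\<bar>"
    unfolding level_error_def level_scale abs_mult using nonneg[OF x] by simp
  also have "\<dots> \<le> c\<^sup>2 * (L * (2 ^ i) powr - \<beta>)"
    using decay(2) L_nonneg nonneg[OF x] by (intro level_le[OF x]) (auto simp: abs_mult)
  finally show "sqrt (f x) * level_error m y i x \<le> c\<^sup>2 * L * (2 ^ i) powr - \<beta>" by simp
  assume "i < m"
  then have "sqrt (2 ^ i) * \<bar>?\<eta> i k\<bar> \<le> L * sqrt (v * 2 ^ i)" if "k \<in> I i" "\<psi> i k x \<noteq> 0" for k
    using acc that mult_right_mono[of "\<bar>?\<eta> i k\<bar>" "L * sqrt v" "sqrt (2 ^ i)"]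
    by (auto simp: accurate_def real_sqrt_mult mult_ac)
  then show "level_error m y i x \<le> c\<^sup>2 * L * sqrt (v * 2 ^ i)"
    unfolding level_error_def mult.assoc[of "c\<^sup>2"] using L_nonneg v by (intro level_le[OF x]) auto
qed

lemma crossing_level_le:
  assumes v: "0 < v" "v \<le> 1" "1 / v \<le> B"
  shows "v powr - (1 / (\<beta> + 1)) \<le> B"
proof -
  have "v powr - (1 / (\<beta> + 1)) \<le> v powr - 1"
    using v exponent_pos by (intro powr_mono') (auto simp: field_simps)
  then show ?thesis using v by (simp add: powr_minus_divide)
qed

lemma root_error_le_rate:
  assumes x: "x \<in> {0..1}" and acc: "accurate L v m y x" and L: "2 * decay_const S K c \<le> L"
    and v: "0 < v" "v \<le> 1" "1 / v \<le> 2 ^ m" and \<beta>1: "0 < \<beta>1" "\<beta>1 \<le> \<beta>"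
  shows "root_error m y x \<le> root_error_const \<beta>1 c L * sqrt (v powr (\<beta> / (\<beta> + 1)))"
proof (rule root_error_le[OF x])
  fix n
  have L_nonneg: "0 \<le> L" using L decay_nonneg by simp
  then have "(\<Sum>i<n. level_error m y i x)
      \<le> c\<^sup>2 * L * balance_const (\<beta> / 2) * v powr (\<beta> / 2 / (2 * (\<beta> / 2) + 1))"
    using v exponent_pos crossing_level_le[OF v]
    by (intro dyadic_balance[of "\<beta> / 2"] level_error_bounds[OF x acc L]) auto
  also have "\<dots> = c\<^sup>2 * L * balance_const (\<beta> / 2) * sqrt (v powr (\<beta> / (\<beta> + 1)))"
    using v by (simp add: powr_half_sqrt[symmetric] powr_powr mult.commute)
  also have "\<dots> \<le> root_error_const \<beta>1 c L * sqrt (v powr (\<beta> / (\<beta> + 1)))"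
    using \<beta>1 L_nonneg by (intro mult_right_mono root_error_const_ge) auto
  finally show "(\<Sum>i<n. level_error m y i x) \<le> root_error_const \<beta>1 c L * sqrt (v powr (\<beta> / (\<beta> + 1)))" .
qed

lemma sqrt_times_root_error_le_rate:
  assumes x: "x \<in> {0..1}" and acc: "accurate L v m y x" and L: "2 * decay_const S K c \<le> L"
    and v: "0 < v" "v \<le> 1" "1 / v \<le> 2 ^ m" and \<beta>1: "0 < \<beta>1" "\<beta>1 \<le> \<beta>"
    and large: "v powr (\<beta> / (\<beta> + 1)) \<le> f x"
  shows "sqrt (f x) * root_error m y x \<le> root_error_const \<beta>1 c L * (f x * v) powr (\<beta> / (2 * \<beta> + 1))"
proof -
  let ?B = "root_error_const \<beta>1 c L"
  have L_nonneg: "0 \<le> L" using L decay_nonneg by simp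
  have "0 < v powr (\<beta> / (\<beta> + 1))" using v by simp
  then have fx: "0 < f x" using large by linarith
  note error = level_error_bounds[OF x acc L less_imp_le[OF v(1)]]
  have crossing: "(f x * v) powr (- 1 / (2 * \<beta> + 1)) \<le> 2 ^ m"
  proof -
    have "(2 * \<beta> + 1) / (\<beta> + 1) = \<beta> / (\<beta> + 1) + 1" using exponent_pos by (simp add: field_simps)
    then have "v powr ((2 * \<beta> + 1) / (\<beta> + 1)) \<le> f x * v"
      using large v by (simp add: powr_add mult_right_mono)
    then have "(f x * v) powr (- 1 / (2 * \<beta> + 1)) \<le> (v powr ((2 * \<beta> + 1) / (\<beta> + 1))) powr (- 1 / (2 * \<beta> + 1))"
      using v exponent_pos by (intro powr_mono2') auto
    also have "\<dots> = v powr - (1 / (\<beta> + 1))" using exponent_pos by (simp add: powr_powr)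
    also have "\<dots> \<le> 2 ^ m" by (rule crossing_level_le[OF v])
    finally show ?thesis .
  qed
  have "root_error m y x \<le> ?B * (f x * v) powr (\<beta> / (2 * \<beta> + 1)) / sqrt (f x)"
  proof (rule root_error_le[OF x])
    fix n
    have "(\<Sum>i<n. sqrt (f x) * level_error m y i x)
        \<le> c\<^sup>2 * L * balance_const \<beta> * (f x * v) powr (\<beta> / (2 * \<beta> + 1))"
    proof (rule dyadic_balance[OF exponent_pos _ _ _ error(3) crossing])
      fix i assume "i < m"
      then have "sqrt (f x) * level_error m y i x \<le> sqrt (f x) * (c\<^sup>2 * L * sqrt (v * 2 ^ i))"
        using error(1) fx by (intro mult_left_mono) auto
      then show "sqrt (f x) * level_error m y i x \<le> c\<^sup>2 * L * sqrt (f x * v * 2 ^ i)"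
        by (simp add: real_sqrt_mult mult_ac)
    qed (use v fx L_nonneg in auto)
    also have "\<dots> \<le> ?B * (f x * v) powr (\<beta> / (2 * \<beta> + 1))"
      using \<beta>1 L_nonneg by (intro mult_right_mono root_error_const_ge) auto
    finally show "(\<Sum>i<n. level_error m y i x) \<le> ?B * (f x * v) powr (\<beta> / (2 * \<beta> + 1)) / sqrt (f x)"
      using fx by (simp add: sum_distrib_left[symmetric] pos_le_divide_eq mult.commute)
  qed
  then show ?thesis using fx by (simp add: pos_le_divide_eq mult.commute)
qed

lemma square_error_le:
  assumes "x \<in> {0..1}"
  shows "\<bar>(\<Sum>i<m. level y i x)\<^sup>2 / 4 - f x\<bar> \<le> (root_error m y x)\<^sup>2 / 4 + sqrt (f x) * root_error m y x"
proof -
  let ?h = "\<Sum>i<m. level y i x" and ?F = "sqrt (f x)"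
  have "?h\<^sup>2 / 4 - f x = (?h - 2 * ?F)\<^sup>2 / 4 + ?F * (?h - 2 * ?F)"
    using nonneg[OF assms] by (simp add: algebra_simps power2_eq_square add_divide_distrib diff_divide_distrib)
  also have "\<bar>\<dots>\<bar> \<le> \<bar>(?h - 2 * ?F)\<^sup>2 / 4\<bar> + \<bar>?F * (?h - 2 * ?F)\<bar>" by (rule abs_triangle_ineq)
  also have "\<dots> = (root_error m y x)\<^sup>2 / 4 + ?F * root_error m y x"
    using nonneg[OF assms] by (simp add: root_error_def abs_mult)
  finally show ?thesis .
qed

lemma pathwise_rate:
  assumes x: "x \<in> {0..1}" and "accurate L v m y x" and L: "2 * decay_const S K c \<le> L"
    and "0 < v" "v \<le> 1" "1 / v \<le> 2 ^ m" and \<beta>1: "0 < \<beta>1" "\<beta>1 \<le> \<beta>"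
  shows "\<bar>(\<Sum>i<m. level y i x)\<^sup>2 / 4 - f x\<bar> \<le> rate_const \<beta>1 c L * pointwise_rate v \<beta> (f x)"
proof -
  let ?E = "root_error m y x" and ?rate = "pointwise_rate v \<beta> (f x)" and ?B = "root_error_const \<beta>1 c L"
  define r where "r = v powr (\<beta> / (\<beta> + 1))"
  have r: "0 \<le> r" "r \<le> ?rate" by (auto simp: r_def pointwise_rate_def)
  have B: "0 \<le> ?B" using L decay_nonneg \<beta>1 by (intro root_error_const_nonneg) auto
  have E: "?E \<le> ?B * sqrt r" unfolding r_def by (rule root_error_le_rate[OF assms])
  have E_nonneg: "0 \<le> ?E" by (simp add: root_error_def)
  have "?E\<^sup>2 \<le> (?B * sqrt r)\<^sup>2" using E E_nonneg by (rule power_mono)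
  also have "\<dots> \<le> ?B\<^sup>2 * ?rate" using r by (simp add: power_mult_distrib mult_left_mono)
  finally have square: "?E\<^sup>2 \<le> ?B\<^sup>2 * ?rate" .
  have product: "sqrt (f x) * ?E \<le> ?B * ?rate"
  proof (cases "f x \<le> r")
    case True
    then have "sqrt (f x) * ?E \<le> sqrt r * (?B * sqrt r)" using E E_nonneg r by (intro mult_mono) auto
    also have "\<dots> = ?B * r" using r by simp
    also have "\<dots> \<le> ?B * ?rate" using r B by (intro mult_left_mono)
    finally show ?thesis .
  next
    case False
    then have "sqrt (f x) * ?E \<le> ?B * (f x * v) powr (\<beta> / (2 * \<beta> + 1))"
      by (intro sqrt_times_root_error_le_rate[OF assms]) (simp add: r_def)
    also have "\<dots> \<le> ?B * ?rate" using B by (intro mult_left_mono) (auto simp: pointwise_rate_def)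
    finally show ?thesis .
  qed
  show ?thesis using square_error_le[OF x, of y m] square product by (simp add: rate_const_def distrib_right)
qed

end

subsection \<open>Gaussian noise\<close>

lemma (in prob_space) std_normal_abs_tail:
  assumes X: "distributed M lborel X (\<lambda>x. ennreal (normal_density 0 1 x))" and u: "0 \<le> u"
  shows "prob {\<omega> \<in> space M. u < \<bar>X \<omega>\<bar>} \<le> sqrt 2 * exp (- u\<^sup>2 / 4)"
proof -
  have [measurable]: "X \<in> borel_measurable M" using distributed_measurable[OF X] by simp
  let ?g = "\<lambda>x::real. exp (x\<^sup>2 / 4)"
  have tilt: "normal_density 0 1 x * ?g x = sqrt 2 * normal_density 0 (sqrt 2) x" for x
  proof -
    have "normal_density 0 1 x * ?g x = 1 / sqrt (2 * pi) * (exp (- x\<^sup>2 / 2) * exp (x\<^sup>2 / 4))"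
      by (simp add: normal_density_def)
    also have "exp (- x\<^sup>2 / 2) * exp (x\<^sup>2 / 4) = exp (- x\<^sup>2 / 4)" by (simp add: exp_add[symmetric])
    also have "1 / sqrt (2 * pi) * exp (- x\<^sup>2 / 4) = sqrt 2 * normal_density 0 (sqrt 2) x"
    proof -
      have "sqrt (2 * pi * (sqrt 2)\<^sup>2) = sqrt 2 * sqrt (2 * pi)" by (simp add: real_sqrt_mult)
      then show ?thesis unfolding normal_density_def by simp
    qed
    finally show ?thesis .
  qed
  have "expectation (\<lambda>\<omega>. ?g (X \<omega>)) = (LINT x|lborel. normal_density 0 1 x * ?g x)"
    by (rule distributed_integral[OF X, symmetric]) auto
  also have "\<dots> = sqrt 2" by (simp add: tilt integral_normal_density)
  finally have moment: "expectation (\<lambda>\<omega>. ?g (X \<omega>)) = sqrt 2" .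
  have integrable: "integrable M (\<lambda>\<omega>. ?g (X \<omega>))"
    by (subst distributed_integrable[OF X, symmetric]) (auto simp: tilt integrable_normal_density)
  have "prob {\<omega> \<in> space M. u < \<bar>X \<omega>\<bar>} \<le> prob {\<omega> \<in> space M. ?g u \<le> ?g (X \<omega>)}"
    using u abs_le_square_iff[of u] by (intro finite_measure_mono) force+
  also have "\<dots> \<le> expectation (\<lambda>\<omega>. ?g (X \<omega>)) / ?g u"
    by (rule integral_Markov_inequality_measure[where A = "space M", OF integrable]) auto
  also have "\<dots> = sqrt 2 * exp (- u\<^sup>2 / 4)" by (simp add: moment exp_minus inverse_eq_divide)
  finally show ?thesis .
qed

lemma isonormal_unit_norm:
  assumes W: "isonormal M W" and g: "g \<in> borel_measurable borel" "continuous_on {0..1} g" "inner_L2 g g = 1"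
  shows "W g \<in> borel_measurable M" "distributed M lborel (W g) (\<lambda>x. ennreal (normal_density 0 1 x))"
proof -
  have "set_integrable lborel {0..1} (\<lambda>t. (g t)\<^sup>2)"
    using set_integrable_mult_continuous[OF g(2,2)] by (simp add: power2_eq_square)
  with W g(1) have "W g \<in> borel_measurable M \<and>
      (let s = sqrt (LINT t:{0..1}|lborel. (g t)\<^sup>2) in
        if 0 < s then distributed M lborel (W g) (\<lambda>x. ennreal (normal_density 0 s x))
        else (AE \<omega> in M. W g \<omega> = 0))"
    unfolding isonormal_def by blast
  then show "W g \<in> borel_measurable M" "distributed M lborel (W g) (\<lambda>x. ennreal (normal_density 0 1 x))"
    using g(3) by (auto simp: power2_eq_square)
qed

context wavelet_system
begin

definition noise_event :: "'a measure \<Rightarrow> ((real \<Rightarrow> real) \<Rightarrow> 'a \<Rightarrow> real) \<Rightarrow> nat \<Rightarrow> real \<Rightarrow> 'a set" where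
  "noise_event M W m u = {\<omega> \<in> space M. \<forall>i<m. \<forall>k\<in>I i. \<bar>W (\<psi> i k) \<omega>\<bar> \<le> u}"

lemma card_levels: "real (card (SIGMA i:{..<m}. I i)) \<le> c * 2 ^ m"
proof -
  have "real (card (SIGMA i:{..<m}. I i)) = (\<Sum>i<m. real (card (I i)))"
    by (simp add: card_SigmaI finite_index)
  also have "\<dots> \<le> (\<Sum>i<m. c * 2 ^ i)" by (intro sum_mono card_index)
  also have "\<dots> = c * (2 ^ m - 1)" by (simp add: sum_distrib_left[symmetric] sum_gp_strict)
  also have "\<dots> \<le> c * 2 ^ m" using c_ge_1 by (intro mult_left_mono) auto
  finally show ?thesis .
qed

lemma noise_event_prob:
  assumes M: "prob_space M" and W: "isonormal M W" and u: "0 \<le> u"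
  shows "noise_event M W m u \<in> sets M"
    and "1 - c * 2 ^ m * (sqrt 2 * exp (- u\<^sup>2 / 4)) \<le> measure M (noise_event M W m u)"
proof -
  interpret prob_space M by (rule M)
  let ?P = "SIGMA i:{..<m}. I i" and ?q = "sqrt 2 * exp (- u\<^sup>2 / 4)"
  define B where "B = (\<lambda>(i, k). {\<omega> \<in> space M. u < \<bar>W (\<psi> i k) \<omega>\<bar>})"
  have finite_P: "finite ?P" using finite_index by auto
  have B: "B p \<in> sets M \<and> prob (B p) \<le> ?q" if p_in: "p \<in> ?P" for p
  proof -
    obtain i k where p: "p = (i, k)" and k: "k \<in> I i" using p_in by auto
    have "inner_L2 (\<psi> i k) (\<psi> i k) = 1" using orthonormal[OF k k] by simp
    note normal = isonormal_unit_norm[OF W measurable_psi[OF k] continuous_psi[OF k] this]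
    have [measurable]: "W (\<psi> i k) \<in> borel_measurable M" by (rule normal(1))
    show ?thesis using std_normal_abs_tail[OF normal(2) u] by (simp add: B_def p)
  qed
  have event: "noise_event M W m u = space M - (\<Union>p\<in>?P. B p)"
    by (auto simp: noise_event_def B_def not_less) (meson not_less)
  have union: "(\<Union>p\<in>?P. B p) \<in> sets M" using B finite_P by (intro sets.finite_UN) auto
  then show "noise_event M W m u \<in> sets M" unfolding event by auto
  have "prob (\<Union>p\<in>?P. B p) \<le> (\<Sum>p\<in>?P. prob (B p))"
    using B finite_P by (intro finite_measure_subadditive_finite) auto
  also have "\<dots> \<le> (\<Sum>p\<in>?P. ?q)" using B by (intro sum_mono) blast
  also have "\<dots> = real (card ?P) * ?q" by simp
  also have "\<dots> \<le> c * 2 ^ m * ?q" by (intro mult_right_mono card_levels) auto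
  finally show "1 - c * 2 ^ m * ?q \<le> measure M (noise_event M W m u)"
    unfolding event using prob_compl[OF union] by simp
qed

lemma noise_event_sample_prob:
  assumes "prob_space M" "isonormal M W" "0 \<le> u" "2 ^ J \<le> real n"
  shows "1 - 4 * c * sqrt 2 * real n * exp (- u\<^sup>2 / 4) \<le> measure M (noise_event M W (J + 2) u)"
proof -
  have "c * 2 ^ (J + 2) * (sqrt 2 * exp (- u\<^sup>2 / 4)) \<le> c * (4 * real n) * (sqrt 2 * exp (- u\<^sup>2 / 4))"
    using assms(4) c_ge_1 by (intro mult_right_mono mult_left_mono) auto
  also have "\<dots> = 4 * c * sqrt 2 * real n * exp (- u\<^sup>2 / 4)" by simp
  finally show ?thesis using noise_event_prob(2)[OF assms(1-3), of "J + 2"] by linarith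
qed

end

definition exceptional_prob :: "real \<Rightarrow> nat \<Rightarrow> real" where
  "exceptional_prob \<tau> n = 3 * real n powr (- (\<tau>\<^sup>2 / 8 - 1)) / sqrt (2 * ln (real n))"

lemma eventually_noise_tail_le:
  assumes \<tau>: "0 < \<tau>"
  shows "\<forall>\<^sub>F n in sequentially.
    a * real n * exp (- (3 / 4 * \<tau> * sqrt (ln (real n)))\<^sup>2 / 4) \<le> exceptional_prob \<tau> n"
proof -
  define \<epsilon> where "\<epsilon> = \<tau>\<^sup>2 / 64"
  have "0 < \<epsilon>" using \<tau> by (simp add: \<epsilon>_def)
  then have "((\<lambda>x. a * (sqrt (2 * ln x) * x powr - \<epsilon>)) \<longlongrightarrow> 0) at_top" by real_asymp
  then have "((\<lambda>n. a * (sqrt (2 * ln (real n)) * real n powr - \<epsilon>)) \<longlongrightarrow> 0) sequentially"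
    by (rule filterlim_compose[OF _ filterlim_real_sequentially])
  then have "\<forall>\<^sub>F n in sequentially. a * (sqrt (2 * ln (real n)) * real n powr - \<epsilon>) < 3"
    by (rule order_tendstoD) simp
  then show ?thesis using eventually_ge_at_top[of 2]
  proof eventually_elim
    case (elim n)
    let ?p = "real n powr (- (\<tau>\<^sup>2 / 8 - 1))"
    have ln: "0 < ln (real n)" using elim(2) by simp
    have "(3 / 4 * \<tau> * sqrt (ln (real n)))\<^sup>2 = 9 / 16 * \<tau>\<^sup>2 * ln (real n)"
      using ln by (simp add: power_mult_distrib power2_eq_square)
    then have "real n * exp (- (3 / 4 * \<tau> * sqrt (ln (real n)))\<^sup>2 / 4)
        = real n powr 1 * real n powr - (9 / 64 * \<tau>\<^sup>2)"
      using elim(2) by (simp add: powr_def)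
    also have "\<dots> = real n powr (1 + - (9 / 64 * \<tau>\<^sup>2))" by (rule powr_add[symmetric])
    also have "1 + - (9 / 64 * \<tau>\<^sup>2) = - (\<tau>\<^sup>2 / 8 - 1) + - \<epsilon>" by (simp add: \<epsilon>_def)
    finally have tail: "real n * exp (- (3 / 4 * \<tau> * sqrt (ln (real n)))\<^sup>2 / 4) = ?p * real n powr - \<epsilon>"
      by (simp only: powr_add)
    have "?p * (a * (sqrt (2 * ln (real n)) * real n powr - \<epsilon>)) \<le> ?p * 3"
      using elim(1) by (intro mult_left_mono) auto
    then have "a * (?p * real n powr - \<epsilon>) * sqrt (2 * ln (real n)) \<le> 3 * ?p" by (simp only: mult_ac)
    then have "a * (?p * real n powr - \<epsilon>) \<le> exceptional_prob \<tau> n"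
      unfolding exceptional_prob_def using ln by (subst pos_le_divide_eq) auto
    then show ?case unfolding mult.assoc[of a] tail .
  qed
qed

text \<open>The number of coefficients carries an arbitrary constant, so at the noise level \<open>\<tau> / 2\<close> the union
  bound may exceed the prescribed probability. The level \<open>3 * \<tau> / 4\<close> leaves a factor \<open>n powr (- \<tau>\<^sup>2 / 64)\<close>
  to absorb it for large \<open>n\<close>; the finitely many other \<open>n\<close> only need some level.\<close>

lemma noise_level_exists:
  assumes \<tau>: "0 < \<tau>"
  obtains U u N where "0 \<le> U" "\<And>n. 0 \<le> u n"
    "\<And>n. u n \<le> 3 / 4 * \<tau> * sqrt (ln (real n)) \<or> u n \<le> U \<and> n \<le> N"
    "\<And>n. 2 \<le> n \<Longrightarrow> a * real n * exp (- (u n)\<^sup>2 / 4) \<le> exceptional_prob \<tau> n"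
proof -
  obtain N where N: "\<And>n. N \<le> n \<Longrightarrow>
      a * real n * exp (- (3 / 4 * \<tau> * sqrt (ln (real n)))\<^sup>2 / 4) \<le> exceptional_prob \<tau> n"
    using eventually_noise_tail_le[OF \<tau>] unfolding eventually_sequentially by blast
  have "\<forall>\<^sub>F U in at_top. \<forall>n\<in>{2..<N}. a * real n * exp (- U\<^sup>2 / 4) \<le> exceptional_prob \<tau> n"
  proof (intro eventually_ball_finite ballI)
    fix n assume "n \<in> {2..<N}"
    then have pos: "0 < exceptional_prob \<tau> n" by (simp add: exceptional_prob_def)
    have "((\<lambda>U. a * real n * exp (- U\<^sup>2 / 4)) \<longlongrightarrow> 0) at_top" by real_asymp
    from order_tendstoD(2)[OF this pos]
    show "\<forall>\<^sub>F U in at_top. a * real n * exp (- U\<^sup>2 / 4) \<le> exceptional_prob \<tau> n"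
      by eventually_elim simp
  qed simp
  then have "\<forall>\<^sub>F U in at_top. 0 \<le> U \<and> (\<forall>n\<in>{2..<N}. a * real n * exp (- U\<^sup>2 / 4) \<le> exceptional_prob \<tau> n)"
    by (intro eventually_conj eventually_ge_at_top)
  then obtain U where U: "0 \<le> U" "\<And>n. n \<in> {2..<N} \<Longrightarrow> a * real n * exp (- U\<^sup>2 / 4) \<le> exceptional_prob \<tau> n"
    unfolding eventually_at_top_linorder by blast
  define u where "u n = (if N \<le> n then 3 / 4 * \<tau> * sqrt (ln (real n)) else U)" for n
  show thesis
  proof (rule that[of U u N])
    fix n
    show "0 \<le> u n" using U(1) \<tau> by (cases "n = 0") (auto simp: u_def)
    show "u n \<le> 3 / 4 * \<tau> * sqrt (ln (real n)) \<or> u n \<le> U \<and> n \<le> N" by (simp add: u_def)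
    show "a * real n * exp (- (u n)\<^sup>2 / 4) \<le> exceptional_prob \<tau> n" if "2 \<le> n"
      using N[of n] U(2)[of n] that by (auto simp: u_def)
  qed (rule U(1))
qed

subsection \<open>Thresholding\<close>

definition hard_threshold :: "real \<Rightarrow> real \<Rightarrow> real" where
  "hard_threshold t y = (if t < \<bar>y\<bar> then y else 0)"

lemma hard_threshold_error:
  assumes "0 \<le> t"
  shows "\<bar>hard_threshold t (a + z) - a\<bar> \<le> \<bar>z\<bar> + t"
    and "\<bar>z\<bar> \<le> 3 / 4 * t \<Longrightarrow> \<bar>hard_threshold t (a + z) - a\<bar> \<le> 3 * \<bar>a\<bar>"
  using assms by (auto simp: hard_threshold_def abs_if split: if_splits)

lemma fhat_eq_levels:
  "fhat W \<psi> I \<tau> n J f \<omega> x = (\<Sum>i<J + 2. \<Sum>k\<in>I (int i - 1).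
     hard_threshold (\<tau> * sqrt (ln (real n) / real n)) (Ycoef W \<psi> n f (int i - 1) k \<omega>) * \<psi> (int i - 1) k x)\<^sup>2 / 4"
proof -
  have "hhat W \<psi> I \<tau> n J f \<omega> x = (\<Sum>j\<in>{-1..int J}. \<Sum>k\<in>I j.
      hard_threshold (\<tau> * sqrt (ln (real n) / real n)) (Ycoef W \<psi> n f j k \<omega>) * \<psi> j k x)"
    unfolding hhat_def hard_threshold_def by (intro sum.cong) auto
  also have "\<dots> = (\<Sum>i<J + 2. \<Sum>k\<in>I (int i - 1).
      hard_threshold (\<tau> * sqrt (ln (real n) / real n)) (Ycoef W \<psi> n f (int i - 1) k \<omega>) * \<psi> (int i - 1) k x)"
    by (rule sum.reindex_bij_witness[where i = "\<lambda>i. int i - 1" and j = "\<lambda>j. nat (j + 1)"]) auto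
  finally show ?thesis by (simp add: fhat_def)
qed

lemma log_ratio_bounds:
  assumes "2 \<le> n"
  shows "0 < ln (real n) / real n" "ln (real n) / real n \<le> 1" "1 / (ln (real n) / real n) \<le> 2 * real n"
    "1 / sqrt (real n) \<le> 2 * sqrt (ln (real n) / real n)"
proof -
  have "ln 2 \<le> ln (real n)" using assms by simp
  then have ln: "1 / 2 \<le> ln (real n)" using ln2_ge_two_thirds by linarith
  show "0 < ln (real n) / real n" "ln (real n) / real n \<le> 1"
    using assms ln_le_minus_one[of "real n"] by auto
  show "1 / (ln (real n) / real n) \<le> 2 * real n"
    using assms ln mult_left_mono[of "1 / 2" "ln (real n)" "2 * real n"] by (simp add: divide_le_eq)
  show "1 / sqrt (real n) \<le> 2 * sqrt (ln (real n) / real n)"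
    using ln assms real_le_rsqrt[of "1 / 2" "ln (real n)"]
    by (simp add: real_sqrt_divide power2_eq_square divide_right_mono)
qed

definition accuracy_const :: "nat \<Rightarrow> real \<Rightarrow> real \<Rightarrow> real \<Rightarrow> real \<Rightarrow> real \<Rightarrow> real" where
  "accuracy_const S K c \<tau> U Q = 2 * \<tau> + 6 * decay_const S K c + (2 * U + \<tau>) * Q ^ (S + 1) * K ^ S"

context flat_Hoelder_wavelets
begin

lemma accurate_mono: "accurate L v m y x \<Longrightarrow> L \<le> L' \<Longrightarrow> 0 \<le> v \<Longrightarrow> accurate L' v m y x"
  unfolding accurate_def by (meson mult_right_mono order_trans powr_ge_zero real_sqrt_ge_zero)

lemma accurate_if_noise_below_threshold:
  assumes x: "x \<in> {0..1}" and \<tau>: "0 \<le> \<tau>" and v: "0 \<le> v"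
    and z: "\<And>i k. i < m \<Longrightarrow> k \<in> I i \<Longrightarrow> \<bar>z i k\<bar> \<le> 3 / 4 * (\<tau> * sqrt v)"
  shows "accurate (2 * \<tau> + 6 * decay_const S K c) v m
    (\<lambda>i k. hard_threshold (\<tau> * sqrt v) (root_coeff i k + z i k)) x"
  unfolding accurate_def
proof (intro allI ballI impI conjI)
  fix i k assume i: "i < m" and k: "k \<in> I i" and nz: "\<psi> i k x \<noteq> 0"
  let ?err = "\<bar>hard_threshold (\<tau> * sqrt v) (root_coeff i k + z i k) - root_coeff i k\<bar>"
  let ?A = "decay_const S K c" and ?L = "2 * \<tau> + 6 * decay_const S K c"
  have t: "0 \<le> \<tau> * sqrt v" using \<tau> v by simp
  have "?err \<le> 2 * (\<tau> * sqrt v)"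
    using hard_threshold_error(1)[OF t, of "root_coeff i k" "z i k"] z[OF i k] t by linarith
  also have "\<dots> \<le> ?L * sqrt v" using decay_nonneg v by (simp add: distrib_right)
  finally show "?err \<le> ?L * sqrt v" .
  have err: "?err \<le> 3 * \<bar>root_coeff i k\<bar>" by (rule hard_threshold_error(2)[OF t z[OF i k]])
  have L: "6 * ?A * (2 ^ i) powr p \<le> ?L * (2 ^ i) powr p" for p using \<tau> by (intro mult_right_mono) auto
  have "sqrt (2 ^ i) * ?err \<le> 3 * (sqrt (2 ^ i) * \<bar>root_coeff i k\<bar>)"
    using mult_left_mono[OF err, of "sqrt (2 ^ i)"] by simp
  also have "\<dots> \<le> 6 * ?A * (2 ^ i) powr - (\<beta> / 2)" using root_coeff_decay(1)[OF k x nz] by linarith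
  finally show "sqrt (2 ^ i) * ?err \<le> ?L * (2 ^ i) powr - (\<beta> / 2)" using L by (rule order_trans)
  have "sqrt (2 ^ i) * (sqrt (f x) * ?err) \<le> 3 * (sqrt (2 ^ i) * (sqrt (f x) * \<bar>root_coeff i k\<bar>))"
    using mult_left_mono[OF err, of "sqrt (2 ^ i) * sqrt (f x)"] nonneg[OF x] by (simp add: mult_ac)
  also have "\<dots> \<le> 6 * ?A * (2 ^ i) powr - \<beta>" using root_coeff_decay(2)[OF k x nz] by linarith
  finally show "sqrt (2 ^ i) * (sqrt (f x) * ?err) \<le> ?L * (2 ^ i) powr - \<beta>" using L by (rule order_trans)
qed

lemma sqrt_le_K_power:
  assumes x: "x \<in> {0..1}"
  shows "sqrt (f x) \<le> K ^ S"
proof -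
  have "sqrt (f x) = (f x powr (1 / \<beta>)) powr (\<beta> / 2)" by (simp add: length_scale_powr[OF x])
  also have "\<dots> \<le> K powr (\<beta> / 2)" using exponent_pos length_scale_le[OF x] by (intro powr_mono2) auto
  also have "\<dots> \<le> K powr real S" using exponent_pos exponent_less K_ge_1 by (intro powr_mono) auto
  finally show ?thesis using K_ge_1 by (simp add: powr_realpow)
qed

text \<open>Covers the finitely many sample sizes at which the noise may exceed the threshold: they involve
  boundedly many levels, on which the decay conditions only cost a constant.\<close>

lemma accurate_if_levels_bounded:
  assumes x: "x \<in> {0..1}" and E: "0 \<le> E" and v: "0 \<le> v" "v \<le> 1" and Q: "\<And>i. i < m \<Longrightarrow> 2 ^ i \<le> Q"
    and err: "\<And>i k. i < m \<Longrightarrow> k \<in> I i \<Longrightarrow> \<bar>y i k - root_coeff i k\<bar> \<le> E * sqrt v"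
  shows "accurate (E * Q ^ (S + 1) * K ^ S) v m y x"
  unfolding accurate_def
proof (intro allI ballI impI conjI)
  fix i k assume i: "i < m" and k: "k \<in> I i"
  let ?err = "\<bar>y i k - root_coeff i k\<bar>" and ?L = "E * Q ^ (S + 1) * K ^ S"
  have "(1::real) \<le> 2 ^ i" by simp
  then have Q_ge_1: "1 \<le> Q" using Q[OF i] by linarith
  have K_power_ge_1: "1 \<le> K ^ S" using K_ge_1 by (rule one_le_power)
  have "1 * 1 \<le> Q ^ (S + 1) * K ^ S"
    using one_le_power[OF Q_ge_1, of "S + 1"] K_power_ge_1 by (intro mult_mono) auto
  then have "E * sqrt v * 1 \<le> E * sqrt v * (Q ^ (S + 1) * K ^ S)"
    using E v by (intro mult_left_mono) auto
  then show "?err \<le> ?L * sqrt v" using err[OF i k] by (simp add: mult_ac)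
  have L: "E * Q * K ^ S \<le> ?L * (2 ^ i) powr - p" if "p \<le> real S" for p
  proof -
    have "(2 ^ i) powr p \<le> (2 ^ i) powr real S" using that by (intro powr_mono) auto
    also have "\<dots> \<le> Q ^ S" using Q[OF i] by (simp add: powr_realpow power_mono)
    finally have "E * Q * K ^ S * (2 ^ i) powr p \<le> E * Q * K ^ S * Q ^ S"
      using E Q_ge_1 K_power_ge_1 by (intro mult_left_mono) auto
    then show ?thesis by (simp add: powr_minus_divide pos_le_divide_eq mult_ac)
  qed
  have "sqrt v \<le> 1" using v by simp
  then have err_E: "?err \<le> E" using err[OF i k] mult_left_mono[of "sqrt v" 1 E] E by simp
  have "2 ^ i \<le> Q * Q" using Q[OF i] mult_left_mono[OF Q_ge_1, of Q] Q_ge_1 by linarith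
  then have "sqrt (2 ^ i) \<le> Q" using Q_ge_1 by (intro real_le_lsqrt) (auto simp: power2_eq_square)
  then have root_err: "sqrt (2 ^ i) * ?err \<le> Q * E" using err_E Q_ge_1 by (intro mult_mono) auto
  also have "Q * E \<le> E * Q * K ^ S"
    using K_power_ge_1 E Q_ge_1 mult_left_mono[OF K_power_ge_1, of "E * Q"] by (simp add: mult_ac)
  finally show "sqrt (2 ^ i) * ?err \<le> ?L * (2 ^ i) powr - (\<beta> / 2)"
    using L[of "\<beta> / 2"] exponent_pos exponent_less by linarith
  have "sqrt (f x) * (sqrt (2 ^ i) * ?err) \<le> K ^ S * (Q * E)"
    by (rule mult_mono[OF sqrt_le_K_power[OF x] root_err]) (use K_power_ge_1 in auto)
  then show "sqrt (2 ^ i) * (sqrt (f x) * ?err) \<le> ?L * (2 ^ i) powr - \<beta>"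
    using L[of \<beta>] exponent_less by (simp add: mult_ac)
qed

lemma accurate_thresholding:
  assumes n: "2 \<le> n" "2 ^ J \<le> real n" and x: "x \<in> {0..1}" and \<tau>: "0 \<le> \<tau>" and U: "0 \<le> U"
    and noise: "\<And>i k. i < J + 2 \<Longrightarrow> k \<in> I i \<Longrightarrow> \<bar>w i k\<bar> \<le> u"
    and u: "u \<le> 3 / 4 * \<tau> * sqrt (ln (real n)) \<or> u \<le> U \<and> n \<le> N"
  defines "v \<equiv> ln (real n) / real n"
  defines "y \<equiv> \<lambda>i k. hard_threshold (\<tau> * sqrt v) (root_coeff i k + w i k / sqrt (real n))"
  shows "accurate (accuracy_const S K c \<tau> U (2 * real N)) v (J + 2) y x"
proof -
  note v = log_ratio_bounds[OF n(1), folded v_def]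
  have z: "\<bar>w i k / sqrt (real n)\<bar> \<le> u / sqrt (real n)" if "i < J + 2" "k \<in> I i" for i k
    using noise[OF that] by (simp add: abs_divide divide_right_mono)
  have const_nonneg: "0 \<le> (2 * U + \<tau>) * (2 * real N) ^ (S + 1) * K ^ S"
    using \<tau> U K_ge_1 by simp
  show ?thesis
    using u
  proof
    assume u: "u \<le> 3 / 4 * \<tau> * sqrt (ln (real n))"
    have "\<bar>w i k / sqrt (real n)\<bar> \<le> 3 / 4 * (\<tau> * sqrt v)" if "i < J + 2" "k \<in> I i" for i k
      using order_trans[OF z[OF that] divide_right_mono[OF u, of "sqrt (real n)"]]
      by (simp add: v_def real_sqrt_divide)
    then have "accurate (2 * \<tau> + 6 * decay_const S K c) v (J + 2) y x"
      unfolding y_def using v by (intro accurate_if_noise_below_threshold[OF x \<tau>]) auto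
    then show ?thesis
      by (rule accurate_mono) (use v const_nonneg in \<open>auto simp: accuracy_const_def\<close>)
  next
    assume u: "u \<le> U \<and> n \<le> N"
    have U_le: "U / sqrt (real n) \<le> 2 * U * sqrt v"
      using mult_left_mono[OF v(4) U] by (simp add: mult_ac)
    have "\<bar>y i k - root_coeff i k\<bar> \<le> (2 * U + \<tau>) * sqrt v" if "i < J + 2" "k \<in> I i" for i k
      using hard_threshold_error(1)[of "\<tau> * sqrt v" "root_coeff i k" "w i k / sqrt (real n)"]
        z[OF that] divide_right_mono[of u U "sqrt (real n)"] u U_le \<tau> v
      by (simp add: y_def distrib_right)
    moreover have "2 ^ i \<le> 2 * real N" if "i < J + 2" for i
    proof -
      have "(2::real) ^ i \<le> 2 ^ (J + 1)" using that by (intro power_increasing) auto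
      also have "\<dots> \<le> 2 * real n" using n(2) by simp
      finally show ?thesis using u by simp
    qed
    ultimately have "accurate ((2 * U + \<tau>) * (2 * real N) ^ (S + 1) * K ^ S) v (J + 2) y x"
      using U \<tau> v by (intro accurate_if_levels_bounded[OF x]) auto
    then show ?thesis
      by (rule accurate_mono) (use v const_nonneg decay_nonneg \<tau> in \<open>auto simp: accuracy_const_def\<close>)
  qed
qed

lemma thresholding_rate:
  assumes n: "2 \<le> n" "real n / 2 \<le> 2 ^ J" "2 ^ J \<le> real n" and x: "x \<in> {0..1}"
    and \<beta>1: "0 < \<beta>1" "\<beta>1 \<le> \<beta>" and \<tau>: "0 \<le> \<tau>" and U: "0 \<le> U"
    and noise: "\<And>i k. i < J + 2 \<Longrightarrow> k \<in> I i \<Longrightarrow> \<bar>w i k\<bar> \<le> u"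
    and u: "u \<le> 3 / 4 * \<tau> * sqrt (ln (real n)) \<or> u \<le> U \<and> n \<le> N"
  shows "\<bar>(\<Sum>i<J + 2. level (\<lambda>i k. hard_threshold (\<tau> * sqrt (ln (real n) / real n))
      (root_coeff i k + w i k / sqrt (real n))) i x)\<^sup>2 / 4 - f x\<bar>
    \<le> rate_const \<beta>1 c (accuracy_const S K c \<tau> U (2 * real N)) * rtilde n \<beta> (f x)"
  unfolding rtilde_eq_pointwise_rate
proof (rule pathwise_rate[OF x])
  show "accurate (accuracy_const S K c \<tau> U (2 * real N)) (ln (real n) / real n) (J + 2)
      (\<lambda>i k. hard_threshold (\<tau> * sqrt (ln (real n) / real n)) (root_coeff i k + w i k / sqrt (real n))) x"
    by (rule accurate_thresholding[OF n(1,3) x \<tau> U noise u])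
  show "2 * decay_const S K c \<le> accuracy_const S K c \<tau> U (2 * real N)"
    using decay_nonneg \<tau> U K_ge_1 by (simp add: accuracy_const_def)
  show "1 / (ln (real n) / real n) \<le> 2 ^ (J + 2)" using log_ratio_bounds(3)[OF n(1)] n(2) by simp
qed (use log_ratio_bounds[OF n(1)] \<beta>1 in auto)

end

lemma noise_event_subset_rate:
  assumes wavelets: "wavelet_system S (\<lambda>i. \<psi> (int i - 1)) (\<lambda>i. I (int i - 1)) c"
    and f: "flat_Hoelder S \<beta> K f"
    and n: "2 \<le> n" "real n / 2 \<le> 2 ^ J" "2 ^ J \<le> real n"
    and \<beta>1: "0 < \<beta>1" "\<beta>1 \<le> \<beta>" and \<tau>: "0 \<le> \<tau>" and U: "0 \<le> U"
    and u: "u \<le> 3 / 4 * \<tau> * sqrt (ln (real n)) \<or> u \<le> U \<and> n \<le> N"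
  shows "wavelet_system.noise_event (\<lambda>i. \<psi> (int i - 1)) (\<lambda>i. I (int i - 1)) M W (J + 2) u \<subseteq>
    {\<omega>\<in>space M. \<forall>x\<in>{0..1}. \<bar>fhat W \<psi> I \<tau> n J f \<omega> x - f x\<bar> / rtilde n \<beta> (f x)
      \<le> rate_const \<beta>1 c (accuracy_const S K c \<tau> U (2 * real N))}"
proof -
  interpret flat_Hoelder_wavelets S "\<lambda>i. \<psi> (int i - 1)" "\<lambda>i. I (int i - 1)" c \<beta> K f
    using wavelets f by (rule flat_Hoelder_wavelets.intro)
  have "\<bar>fhat W \<psi> I \<tau> n J f \<omega> x - f x\<bar> / rtilde n \<beta> (f x)
      \<le> rate_const \<beta>1 c (accuracy_const S K c \<tau> U (2 * real N))"
    if \<omega>: "\<omega> \<in> noise_event M W (J + 2) u" and x: "x \<in> {0..1}" for \<omega> x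
  proof -
    have "\<bar>W (\<psi> (int i - 1) k) \<omega>\<bar> \<le> u" if "i < J + 2" "k \<in> I (int i - 1)" for i k
      using \<omega> that by (simp add: noise_event_def)
    note error = thresholding_rate[OF n x \<beta>1 \<tau> U this u]
    have "\<bar>fhat W \<psi> I \<tau> n J f \<omega> x - f x\<bar>
        \<le> rate_const \<beta>1 c (accuracy_const S K c \<tau> U (2 * real N)) * rtilde n \<beta> (f x)"
      using error unfolding fhat_eq_levels level_def root_coeff_def Ycoef_def .
    moreover have "0 < rtilde n \<beta> (f x)" using n(1) by (auto simp: rtilde_def less_max_iff_disj)
    ultimately show ?thesis by (simp add: pos_divide_le_eq)
  qed
  moreover have "noise_event M W (J + 2) u \<subseteq> space M" by (auto simp: noise_event_def)
  ultimately show ?thesis by blast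
qed

theorem theorem3p1:
  fixes S :: nat and \<psi> :: "int \<Rightarrow> int \<Rightarrow> real \<Rightarrow> real" and I :: "int \<Rightarrow> int set"
    and \<beta>1 \<beta>2 R1 R2 \<tau> :: real
    and M :: "'a measure" and W :: "(real \<Rightarrow> real) \<Rightarrow> 'a \<Rightarrow> real"
  assumes "0 < S" and "wavelet_basis S \<psi> I"
    and "0 < \<beta>1" and "\<beta>1 \<le> \<beta>2" and "\<beta>2 < real S"
    and "0 < R1" and "R1 \<le> R2"
    and "2 * sqrt 2 < \<tau>"
    and "prob_space M" and "isonormal M W"
  shows "\<exists>C. \<forall>n::nat. \<forall>J::nat. \<forall>\<beta> R. \<forall>f :: real \<Rightarrow> real.
           2 \<le> n \<longrightarrow> real n / 2 \<le> 2 ^ J \<longrightarrow> 2 ^ J \<le> real n \<longrightarrow>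
           \<beta>1 \<le> \<beta> \<longrightarrow> \<beta> \<le> \<beta>2 \<longrightarrow> R1 \<le> R \<longrightarrow> R \<le> R2 \<longrightarrow> H_ball \<beta> R f \<longrightarrow>
           (\<exists>A\<in>sets M.
              A \<subseteq> {\<omega>\<in>space M. \<forall>x\<in>{0..1}.
                     \<bar>fhat W \<psi> I \<tau> n J f \<omega> x - f x\<bar> / rtilde n \<beta> (f x) \<le> C} \<and>
              1 - 3 * real n powr (-(\<tau>\<^sup>2 / 8 - 1)) / sqrt (2 * ln (real n)) \<le> measure M A)"
proof -
  obtain c where wavelets: "wavelet_system S (\<lambda>i. \<psi> (int i - 1)) (\<lambda>i. I (int i - 1)) c"
    using wavelet_basis_imp_system[OF assms(2)] .
  interpret wavelet_system S "\<lambda>i. \<psi> (int i - 1)" "\<lambda>i. I (int i - 1)" c by (rule wavelets)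
  have \<tau>: "0 < \<tau>" using assms(8) real_sqrt_ge_zero[of 2] by linarith
  obtain U u N where U: "0 \<le> U" and u: "\<And>n. 0 \<le> u n"
      "\<And>n. u n \<le> 3 / 4 * \<tau> * sqrt (ln (real n)) \<or> u n \<le> U \<and> n \<le> N"
    and tail: "\<And>n. 2 \<le> n \<Longrightarrow> 4 * c * sqrt 2 * real n * exp (- (u n)\<^sup>2 / 4) \<le> exceptional_prob \<tau> n"
    using noise_level_exists[OF \<tau>, where a = "4 * c * sqrt 2"] by blast
  show ?thesis
  proof (intro exI allI impI bexI[where x = "noise_event M W (_ + 2) (u _)"] conjI)
    fix n J \<beta> R f
    assume n: "2 \<le> n" "real n / 2 \<le> 2 ^ J" "2 ^ J \<le> real n" and \<beta>: "\<beta>1 \<le> \<beta>" "\<beta> \<le> \<beta>2"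
      and R: "R \<le> R2" and H: "H_ball \<beta> R f"
    have f: "flat_Hoelder S \<beta> (flat_const S \<beta>1 R2) f"
      using H_ball_imp_flat_Hoelder[OF H R assms(3) \<beta>(1)] \<beta>(2) assms(5) by simp
    show "noise_event M W (J + 2) (u n) \<subseteq> {\<omega>\<in>space M. \<forall>x\<in>{0..1}.
        \<bar>fhat W \<psi> I \<tau> n J f \<omega> x - f x\<bar> / rtilde n \<beta> (f x)
          \<le> rate_const \<beta>1 c (accuracy_const S (flat_const S \<beta>1 R2) c \<tau> U (2 * real N))}"
      by (rule noise_event_subset_rate[OF wavelets f n assms(3) \<beta>(1) less_imp_le[OF \<tau>] U u(2)])
    show "1 - 3 * real n powr (-(\<tau>\<^sup>2 / 8 - 1)) / sqrt (2 * ln (real n))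
        \<le> measure M (noise_event M W (J + 2) (u n))"
      using noise_event_sample_prob[OF assms(9,10) u(1)[of n] n(3)] tail[OF n(1)]
      unfolding exceptional_prob_def by linarith
    show "noise_event M W (J + 2) (u n) \<in> sets M" by (rule noise_event_prob(1)[OF assms(9,10) u(1)])
  qed
qed

end
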